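(* Let $H$ be a separable infinite dimensional complex Hilbert space and let $D\in B(H)$ be an idempotent ($D^2=D$) of infinite rank. Then the following are equivalent: (i) $D$ is not a Hilbert--Schmidt perturbation of a projection, i.e., there are no projection $P\in B(H)$ and Hilbert--Schmidt operator $K$ with $D=P+K$; (ii) the nilpotent part of $D$ is not Hilbert--Schmidt; (iii) $R\{\operatorname{Tr} D\}=\mathbb{C}$; (iv) $D$ is zero-diagonal; (v) $D$ has an absolutely summable diagonal, i.e., there is a basis $\{e_j\}_{j=1}^\infty$ of $H$ with $\sum_j |(De_j,e_j)|<\infty$; (vi) $D$ has a summable diagonal, i.e., $R\{\operatorname{Tr} D\}\neq\emptyset$.
   Context: A "basis" always means an orthonormal basis. A projection is an operator $P$ with $P^2=P=P^*$. An operator $T\in B(H)$ is zero-diagonal if there is a basis $\{e_j\}$ of $H$ with $(Te_j,e_j)=0$ for all $j$. Nilpotent part: with respect to the decomposition $H=(\ker D)^\perp\oplus\ker D$, an idempotent $D$ has block form $D=\begin{pmatrix} I & 0\\ T & 0\end{pmatrix}$ with $I$ the identity on $(\ker D)^\perp$ and $T\in B((\ker D)^\perp,\ker D)$; the operator $T$ is called the nilpotent part of $D$. Set of traces: for $T\in B(H)$ and a basis $\mathfrak e=\{e_j\}_{j=1}^\infty$ of $H$ ordered by $\mathbb{N}$, if the partial sums $\sum_{j=1}^n (Te_j,e_j)$ converge to some $s\in\mathbb{C}$ as $n\to\infty$, put $\operatorname{Tr}_{\mathfrak e}T:=s$. Then $R\{\operatorname{Tr} T\}\subseteq\mathbb{C}$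 is the set of all values $\operatorname{Tr}_{\mathfrak e}T$ as $\mathfrak e$ ranges over all bases (ordered by $\mathbb{N}$) for which $\operatorname{Tr}_{\mathfrak e}T$ is defined. *)

theory Defs
  imports "HOL-Analysis.Analysis"
begin

text \<open>
  A complex inner product space is a real one, with a complex scalar multiplication and a complex
  inner product whose real part is the given real inner product. Norm, metric, topology and positive
  definiteness are thus those of \<^class>\<open>real_inner\<close>. The complex inner product is linear in its
  first and conjugate-linear in its second argument.
\<close>

class complex_inner = real_inner +
  fixes scaleC :: "complex \<Rightarrow> 'a \<Rightarrow> 'a"
    and cinner :: "'a \<Rightarrow> 'a \<Rightarrow> complex"
  assumes scaleC_add_right: "scaleC a (x + y) = scaleC a x + scaleC a y"
    and scaleC_add_left: "scaleC (a + b) x = scaleC a x + scaleC b x"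
    and scaleC_scaleC: "scaleC a (scaleC b x) = scaleC (a * b) x"
    and scaleC_of_real: "scaleC (of_real r) x = scaleR r x"
    and cinner_commute: "cinner x y = cnj (cinner y x)"
    and cinner_add_left: "cinner (x + y) z = cinner x z + cinner y z"
    and cinner_scaleC_left: "cinner (scaleC a x) y = a * cinner x y"
    and Re_cinner: "Re (cinner x y) = inner x y"

class complex_hilbert = complex_inner + complete_space

global_interpretation complex_vector: vector_space "scaleC :: complex \<Rightarrow> 'a \<Rightarrow> 'a::complex_inner"
  defines cspan = complex_vector.span
proof unfold_locales
  show "scaleC 1 x = x" for x :: 'a
    using scaleC_of_real[of 1 x] by simp
qed (simp_all add: scaleC_add_right scaleC_add_left scaleC_scaleC)

definition infinite_cdim :: "'a::complex_inner set \<Rightarrow> bool" where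
  "infinite_cdim S \<longleftrightarrow> \<not> (\<exists>B. finite B \<and> S \<subseteq> cspan B)"

definition corthogonal :: "'a::complex_inner set \<Rightarrow> 'a set" where
  "corthogonal M = {x. \<forall>y\<in>M. cinner x y = 0}"

text \<open>Orthonormal bases of a closed subspace \<open>M\<close>, as sets of vectors.\<close>

definition orthonormal_basis :: "'a::complex_inner set \<Rightarrow> 'a set \<Rightarrow> bool" where
  "orthonormal_basis M E \<longleftrightarrow>
     (\<forall>x\<in>E. \<forall>y\<in>E. cinner x y = (if x = y then 1 else 0)) \<and> closure (cspan E) = M"

definition orthonormal_basis_seq :: "(nat \<Rightarrow> 'a::complex_inner) \<Rightarrow> bool" where
  "orthonormal_basis_seq e \<longleftrightarrow> inj e \<and> orthonormal_basis UNIV (range e)"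

definition bounded_clinear :: "('a::complex_inner \<Rightarrow> 'a) \<Rightarrow> bool" where
  "bounded_clinear T \<longleftrightarrow> bounded_linear T \<and> (\<forall>a x. T (scaleC a x) = scaleC a (T x))"

text \<open>The adjoint is given as a relation, \<open>is_cadjoint S T\<close> meaning \<open>S = T\<^sup>*\<close>.\<close>

definition is_cadjoint :: "('a::complex_inner \<Rightarrow> 'a) \<Rightarrow> ('a \<Rightarrow> 'a) \<Rightarrow> bool" where
  "is_cadjoint S T \<longleftrightarrow> (\<forall>x y. cinner (T x) y = cinner x (S y))"

definition is_idempotent :: "('a::complex_inner \<Rightarrow> 'a) \<Rightarrow> bool" where
  "is_idempotent D \<longleftrightarrow> bounded_clinear D \<and> D \<circ> D = D"

definition is_projection :: "('a::complex_inner \<Rightarrow> 'a) \<Rightarrow> bool" where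
  "is_projection P \<longleftrightarrow> bounded_clinear P \<and> P \<circ> P = P \<and> is_cadjoint P P"

text \<open>
  For a bounded operator \<open>T\<close> defined (at least) on the closed subspace \<open>M\<close>. The sum does not depend
  on the orthonormal basis of \<open>M\<close>.
\<close>

definition hilbert_schmidt_on :: "'a::complex_inner set \<Rightarrow> ('a \<Rightarrow> 'a) \<Rightarrow> bool" where
  "hilbert_schmidt_on M T \<longleftrightarrow>
     (\<exists>E. orthonormal_basis M E \<and> (\<lambda>e. (norm (T e))\<^sup>2) summable_on E)"

definition hilbert_schmidt :: "('a::complex_inner \<Rightarrow> 'a) \<Rightarrow> bool" where
  "hilbert_schmidt K \<longleftrightarrow> bounded_clinear K \<and> hilbert_schmidt_on UNIV K"

definition ker :: "('a::complex_inner \<Rightarrow> 'a) \<Rightarrow> 'a set" where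
  "ker T = {x. T x = 0}"

definition orthogonal_proj :: "'a::complex_inner set \<Rightarrow> 'a \<Rightarrow> 'a" where
  "orthogonal_proj M x = (THE p. p \<in> M \<and> x - p \<in> corthogonal M)"

text \<open>
  The lower left corner of the block matrix of \<open>D\<close> with respect to the decomposition into
  \<open>corthogonal (ker D)\<close> and \<open>ker D\<close>. It is meant as an operator from \<open>corthogonal (ker D)\<close> to
  \<open>ker D\<close>; its values outside \<open>corthogonal (ker D)\<close> are irrelevant.
\<close>

definition nilpotent_part :: "('a::complex_inner \<Rightarrow> 'a) \<Rightarrow> 'a \<Rightarrow> 'a" where
  "nilpotent_part D x = orthogonal_proj (ker D) (D x)"

lemma nilpotent_part_block_form:
  assumes D: "is_idempotent D" and x: "x \<in> corthogonal (ker D)"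
  shows "nilpotent_part D x \<in> ker D" and "D x = x + nilpotent_part D x"
proof -
  have lin: "bounded_linear D" and DD: "D (D y) = D y" for y
    using D by (auto simp: is_idempotent_def bounded_clinear_def fun_eq_iff)
  interpret bounded_linear D by (rule lin)
  have minus: "cinner (a - b) c = cinner a c - cinner b c" for a b c :: 'a
    using cinner_add_left[of "a - b" b c] by simp
  have k: "D x - x \<in> ker D" by (simp add: ker_def diff DD)
  have "nilpotent_part D x = D x - x"
    unfolding nilpotent_part_def orthogonal_proj_def
  proof (rule the_equality)
    show "D x - x \<in> ker D \<and> D x - (D x - x) \<in> corthogonal (ker D)"
      using k x by simp
  next
    fix p assume p: "p \<in> ker D \<and> D x - p \<in> corthogonal (ker D)"
    define q where "q = D x - x - p"
    have "q \<in> ker D" using p k by (simp add: q_def ker_def diff)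
    moreover have "q = (D x - p) - x" by (simp add: q_def)
    ultimately have "cinner q q = 0"
      using p x by (simp add: corthogonal_def minus)
    then have "q = 0" using Re_cinner[of q q] by simp
    then show "p = D x - x" by (simp add: q_def)
  qed
  then show "nilpotent_part D x \<in> ker D" and "D x = x + nilpotent_part D x"
    using k by simp_all
qed

text \<open>The set \<open>R{Tr T}\<close> of all values of the trace over bases ordered by the natural numbers.\<close>

definition trace_set :: "('a::complex_inner \<Rightarrow> 'a) \<Rightarrow> complex set" where
  "trace_set T = {s. \<exists>e. orthonormal_basis_seq e \<and> (\<lambda>j. cinner (T (e j)) (e j)) sums s}"

definition zero_diagonal :: "('a::complex_inner \<Rightarrow> 'a) \<Rightarrow> bool" where
  "zero_diagonal T \<longleftrightarrow> (\<exists>E. orthonormal_basis UNIV E \<and> (\<forall>e\<in>E. cinner (T e) e = 0))"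

definition absolutely_summable_diagonal :: "('a::complex_inner \<Rightarrow> 'a) \<Rightarrow> bool" where
  "absolutely_summable_diagonal T \<longleftrightarrow>
     (\<exists>e. orthonormal_basis_seq e \<and> summable (\<lambda>j. cmod (cinner (T (e j)) (e j))))"

definition summable_diagonal :: "('a::complex_inner \<Rightarrow> 'a) \<Rightarrow> bool" where
  "summable_diagonal T \<longleftrightarrow> trace_set T \<noteq> {}"

end

theory Submission
  imports Defs
begin

text \<open>
  Let \<open>L = (ker D)\<^sup>\<bottom>\<close> and let \<open>T\<close> be the nilpotent part, so \<open>(D(x + y), x + y) = |x|\<^sup>2 + (Tx, y)\<close> for
  \<open>x \<in> L\<close> and \<open>y \<in> ker D\<close>. If \<open>T\<close> is Hilbert-Schmidt, AM-GM absorbs the cross term up to a summable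
  error, and the diagonal sums diverge because \<open>L\<close> is infinite dimensional.

  If \<open>T\<close> is not Hilbert-Schmidt, then orthogonally to any finite set there are finite orthonormal
  systems \<open>x\<^sub>i \<in> L\<close> and \<open>y\<^sub>i \<in> ker D\<close> with \<open>(Tx\<^sub>i, y\<^sub>i) = c\<^sub>i > 0\<close> and \<open>\<Sum>c\<^sub>i\<^sup>2\<close> as large as desired. The
  numerical range of \<open>D\<close> on the span of \<open>x\<^sub>i\<close> and \<open>y\<^sub>i\<close> contains a disc about 0 of radius proportional
  to \<open>c\<^sub>i\<^sup>2\<close>, so any complex number \<open>s\<close> is split into diagonal entries \<open>t\<^sub>i s\<close> with \<open>t\<^sub>i \<ge> 0\<close> and
  \<open>\<Sum>t\<^sub>i = 1\<close>. Taking \<open>s = -(Du, u)\<close>, a chain of rotations of pairs turns \<open>u\<close> and these vectors into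
  a basis of their span with zero diagonal. Exhausting a dense sequence extends every finite
  orthonormal set to a basis whose further diagonal entries all vanish.
\<close>

section \<open>Complex inner product spaces\<close>

text \<open>Squares of the c_i appear because two terms compete: on a unit vector with weight b on
  x_i and the rest on y_i, the form takes the values b^2 + b sqrt(1 - b^2) c_i \<omega> with a free
  phase \<omega>. The cross term dominates the unwanted b^2 only for b at most of order c_i, which
  leaves a disc of radius of order c_i^2. The obstacle is that T may fail to be compact and then has
  no singular value decomposition; the pairs are taken from restrictions to finite-dimensional
  subspaces, where unit spheres are compact. Splitting s into non-negative multiples of itself keeps
  the diagonal entries on one real line, so each rotation needs only a real intermediate value
  argument. Since a single basis witnesses the Hilbert-Schmidt property, orthonormal systems are
  compared through the scalar functionals (Kx, y), without forming adjoints.\<close>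

lemma cinner_scaleC_right: "cinner x (scaleC a y) = cnj a * cinner x y"
  by (metis cinner_commute cinner_scaleC_left complex_cnj_mult)

lemma cinner_self: "cinner x x = of_real ((norm x)\<^sup>2)"
  using cinner_commute[of x x] Re_cinner[of x x] by (simp add: complex_eq_iff power2_norm_eq_inner)

lemma norm_sq_cinner: "(norm x)\<^sup>2 = Re (cinner x x)"
  by (simp add: cinner_self)

lemma cmod_cinner_commute: "cmod (cinner x y) = cmod (cinner y x)"
  by (metis cinner_commute complex_mod_cnj)

lemma cinner_eq_0_commute: "cinner x y = 0 \<longleftrightarrow> cinner y x = 0"
  by (metis cinner_commute complex_cnj_zero)

lemma norm_scaleC: "norm (scaleC a x) = cmod a * norm x"
proof (rule power2_eq_imp_eq)
  have "complex_of_real ((norm (scaleC a x))\<^sup>2) = of_real ((cmod a * norm x)\<^sup>2)"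
    unfolding cinner_self[symmetric] cinner_scaleC_left cinner_scaleC_right
    by (simp only: cinner_self power_mult_distrib of_real_mult complex_norm_square mult_ac)
  then show "(norm (scaleC a x))\<^sup>2 = (cmod a * norm x)\<^sup>2" using of_real_eq_iff by blast
qed auto

lemma cauchy_schwarz_cinner: "cmod (cinner x y) \<le> norm x * norm y"
proof -
  have "(cmod (cinner x y))\<^sup>2 = Re (cinner (scaleC (cnj (cinner x y)) x) y)"
    unfolding cinner_scaleC_left cmod_power2 by (simp add: power2_eq_square)
  also have "\<dots> = inner (scaleC (cnj (cinner x y)) x) y" by (simp add: Re_cinner)
  also have "\<dots> \<le> norm (scaleC (cnj (cinner x y)) x) * norm y" by (rule norm_cauchy_schwarz)
  also have "norm (scaleC (cnj (cinner x y)) x) = cmod (cinner x y) * norm x"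
    by (simp add: norm_scaleC)
  finally show ?thesis
    by (cases "cinner x y = 0") (simp_all add: power2_eq_square mult.assoc)
qed

lemma bounded_bilinear_cinner: "bounded_bilinear (cinner :: 'a::complex_inner \<Rightarrow> 'a \<Rightarrow> complex)"
proof
  show "cinner x (y + z) = cinner x y + cinner x z" for x y z :: 'a
    by (metis cinner_commute cinner_add_left complex_cnj_add)
  show scl: "cinner (r *\<^sub>R x) y = r *\<^sub>R cinner x y" for r and x y :: 'a
    by (metis scaleC_of_real cinner_scaleC_left scaleR_conv_of_real)
  show "cinner x (r *\<^sub>R y) = r *\<^sub>R cinner x y" for r and x y :: 'a
    by (metis cinner_commute scl complex_cnj_scaleR)
qed (auto simp: cinner_add_left intro!: exI[of _ 1] cauchy_schwarz_cinner)

interpretation cinner: bounded_bilinear cinner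
  by (rule bounded_bilinear_cinner)

interpretation scaleC: bounded_bilinear "scaleC :: complex \<Rightarrow> 'a::complex_inner \<Rightarrow> 'a"
proof
  show "scaleC (r *\<^sub>R a) b = r *\<^sub>R scaleC a b" "scaleC a (r *\<^sub>R b) = r *\<^sub>R scaleC a b"
    for r a and b :: 'a
    by (simp_all add: scaleC_of_real[symmetric] scaleC_scaleC scaleR_conv_of_real mult.commute)
qed (auto simp: scaleC_add_left scaleC_add_right norm_scaleC intro!: exI[of _ 1])

section \<open>Orthonormal sets\<close>

definition orthonormal :: "'a::complex_inner set \<Rightarrow> bool" where
  "orthonormal E \<longleftrightarrow> (\<forall>x\<in>E. \<forall>y\<in>E. cinner x y = (if x = y then 1 else 0))"

lemma orthonormal_basis_iff: "orthonormal_basis M E \<longleftrightarrow> orthonormal E \<and> closure (cspan E) = M"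
  by (simp add: orthonormal_basis_def orthonormal_def)

lemma orthonormal_cinner:
  "orthonormal E \<Longrightarrow> x \<in> E \<Longrightarrow> y \<in> E \<Longrightarrow> cinner x y = (if x = y then 1 else 0)"
  by (simp add: orthonormal_def)

lemma orthonormal_subset: "orthonormal E \<Longrightarrow> F \<subseteq> E \<Longrightarrow> orthonormal F"
  unfolding orthonormal_def by blast

lemma orthonormal_norm: "orthonormal E \<Longrightarrow> x \<in> E \<Longrightarrow> norm x = 1"
  using norm_sq_cinner[of x] orthonormal_cinner[of E x x]
  by (intro power2_eq_imp_eq[of "norm x" 1]) simp_all

lemma orthonormal_insert_iff:
  assumes "orthonormal E" "\<And>x. x \<in> E \<Longrightarrow> cinner u x = 0" "norm u = 1"
  shows "orthonormal (insert u E)"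
proof -
  have "cinner x u = 0" if "x \<in> E" for x
    using assms(2)[OF that] cinner_eq_0_commute by blast
  then show ?thesis
    using assms cinner_self[of u] by (auto simp: orthonormal_def)
qed

lemma cinner_cspan_eq_0:
  assumes "\<And>s. s \<in> S \<Longrightarrow> cinner x s = 0" "y \<in> cspan S"
  shows "cinner x y = 0"
  using assms(2)
proof (induction rule: complex_vector.span_induct)
  case base
  show ?case
    by (auto simp: complex_vector.subspace_def cinner.zero_right cinner.add_right
        cinner_scaleC_right)
qed (use assms(1) in auto)

lemma cinner_closure_cspan_eq_0:
  assumes "\<And>s. s \<in> S \<Longrightarrow> cinner x s = 0" "y \<in> closure (cspan S)"
  shows "cinner x y = 0"
proof -
  have "closed {y. cinner x y = 0}"
    by (intro closed_Collect_eq continuous_on_const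
        bounded_linear.continuous_on[OF cinner.bounded_linear_right] continuous_on_id)
  moreover have "cspan S \<subseteq> {y. cinner x y = 0}"
    using cinner_cspan_eq_0 assms(1) by blast
  ultimately show ?thesis
    using assms(2) closure_minimal by blast
qed

lemma cinner_sum_orthonormal:
  assumes "finite F" "orthonormal F" "f \<in> F"
  shows "cinner (\<Sum>e\<in>F. scaleC (c e) e) f = c f"
proof -
  have "cinner (\<Sum>e\<in>F. scaleC (c e) e) f = (\<Sum>e\<in>F. if e = f then c e else 0)"
    unfolding cinner.sum_left
    by (intro sum.cong) (auto simp: cinner_scaleC_left orthonormal_cinner[OF assms(2) _ assms(3)])
  then show ?thesis using assms by (simp add: sum.delta)
qed

lemma norm_sq_sum_orthonormal:
  assumes "finite F" "orthonormal F"
  shows "(norm (\<Sum>e\<in>F. scaleC (c e) e))\<^sup>2 = (\<Sum>e\<in>F. (cmod (c e))\<^sup>2)"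
proof -
  have "complex_of_real ((norm (\<Sum>e\<in>F. scaleC (c e) e))\<^sup>2)
      = (\<Sum>f\<in>F. cnj (c f) * cinner (\<Sum>e\<in>F. scaleC (c e) e) f)"
    unfolding cinner_self[symmetric] 
    by (subst cinner.sum_right) (simp add: cinner_scaleC_right)
  also have "\<dots> = (\<Sum>f\<in>F. of_real ((cmod (c f))\<^sup>2))"
    by (intro sum.cong) (simp_all only: cinner_sum_orthonormal[OF assms] complex_norm_square mult.commute)
  finally show ?thesis
    by (simp only: of_real_sum[symmetric] of_real_eq_iff)
qed

lemma norm_sq_add:
  "(norm (x + y))\<^sup>2 = (norm x)\<^sup>2 + 2 * Re (cinner x y) + (norm y)\<^sup>2"
  unfolding Re_cinner power2_norm_eq_inner inner_add_left inner_add_right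
  by (simp add: inner_commute)

lemma best_approximation:
  fixes F :: "'a::complex_inner set"
  assumes "finite F" "orthonormal F" "y \<in> cspan F"
  shows "norm (x - (\<Sum>e\<in>F. scaleC (cinner x e) e)) \<le> norm (x - y)"
proof -
  define p where "p = (\<Sum>e\<in>F. scaleC (cinner x e) e)"
  have "p \<in> cspan F"
    unfolding p_def by (intro complex_vector.span_sum complex_vector.span_scale complex_vector.span_base)
  then have py: "p - y \<in> cspan F" using assms(3) by (rule complex_vector.span_diff)
  have "cinner (x - p) e = 0" if "e \<in> F" for e
    unfolding p_def cinner.diff_left using that by (simp add: cinner_sum_orthonormal assms)
  then have "cinner (x - p) (p - y) = 0" using py by (rule cinner_cspan_eq_0)
  then have "(norm (x - y))\<^sup>2 = (norm (x - p))\<^sup>2 + (norm (p - y))\<^sup>2"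
    using norm_sq_add[of "x - p" "p - y"] by simp
  then have "(norm (x - p))\<^sup>2 \<le> (norm (x - y))\<^sup>2" by simp
  then show ?thesis unfolding p_def by (rule power2_le_imp_le) simp
qed

lemma orthonormal_expansion:
  assumes "finite F" "orthonormal F" "x \<in> cspan F"
  shows "(\<Sum>e\<in>F. scaleC (cinner x e) e) = x"
  using best_approximation[OF assms, of x] by simp

lemma bessel_diff:
  assumes "finite F" "orthonormal F"
  shows "(norm (x - (\<Sum>e\<in>F. scaleC (cinner x e) e)))\<^sup>2
    = (norm x)\<^sup>2 - (\<Sum>e\<in>F. (cmod (cinner x e))\<^sup>2)"
proof -
  define p where "p = (\<Sum>e\<in>F. scaleC (cinner x e) e)"
  have "p \<in> cspan F"
    unfolding p_def by (intro complex_vector.span_sum complex_vector.span_scale complex_vector.span_base)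
  have "cinner (x - p) e = 0" if "e \<in> F" for e
    unfolding p_def cinner.diff_left using that by (simp add: cinner_sum_orthonormal assms)
  then have "cinner (x - p) p = 0" using \<open>p \<in> cspan F\<close> by (rule cinner_cspan_eq_0)
  then have "(norm x)\<^sup>2 = (norm (x - p))\<^sup>2 + (norm p)\<^sup>2"
    using norm_sq_add[of "x - p" p] by simp
  moreover have "(norm p)\<^sup>2 = (\<Sum>e\<in>F. (cmod (cinner x e))\<^sup>2)"
    unfolding p_def by (rule norm_sq_sum_orthonormal[OF assms])
  ultimately show ?thesis unfolding p_def[symmetric] by linarith
qed

lemma bessel_le:
  assumes "finite F" "orthonormal F"
  shows "(\<Sum>e\<in>F. (cmod (cinner x e))\<^sup>2) \<le> (norm x)\<^sup>2"
proof -
  have "0 \<le> (norm (x - (\<Sum>e\<in>F. scaleC (cinner x e) e)))\<^sup>2" by simp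
  then show ?thesis unfolding bessel_diff[OF assms] by linarith
qed

lemma parseval_finite:
  assumes "finite F" "orthonormal F" "x \<in> cspan F"
  shows "(\<Sum>e\<in>F. (cmod (cinner x e))\<^sup>2) = (norm x)\<^sup>2"
  using bessel_diff[OF assms(1,2), of x] unfolding orthonormal_expansion[OF assms] by simp

lemma cspan_finite_subset:
  assumes "x \<in> cspan E"
  obtains F where "finite F" "F \<subseteq> E" "x \<in> cspan F"
proof -
  obtain t r where t: "finite t" "t \<subseteq> E" "x = (\<Sum>a\<in>t. scaleC (r a) a)"
    using assms unfolding complex_vector.span_explicit by blast
  have "x \<in> cspan t" unfolding t(3)
    by (intro complex_vector.span_sum complex_vector.span_scale complex_vector.span_base)
  with t that show thesis by blast
qed

lemma gram_schmidt_step: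
  fixes G :: "'a::complex_inner set"
  assumes G: "finite G" "orthonormal G" and v: "v \<notin> cspan G"
  obtains u where "u \<notin> G" "orthonormal (insert u G)" "v \<in> cspan (insert u G)"
    "u \<in> cspan (insert v G)"
proof -
  define p where "p = (\<Sum>e\<in>G. scaleC (cinner v e) e)"
  define u where "u = scaleC (of_real (inverse (norm (v - p)))) (v - p)"
  have p: "p \<in> cspan G"
    unfolding p_def by (intro complex_vector.span_sum complex_vector.span_scale complex_vector.span_base)
  then have ne: "v - p \<noteq> 0" using v by auto
  have orth: "cinner (v - p) e = 0" if "e \<in> G" for e
    unfolding p_def cinner.diff_left using that by (simp add: cinner_sum_orthonormal G)
  have nu: "norm u = 1" using ne by (simp add: u_def norm_scaleC norm_inverse)
  have ou: "cinner u e = 0" if "e \<in> G" for e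
    using orth[OF that] by (simp add: u_def cinner_scaleC_left)
  have "u \<notin> G"
    using ou[of u] nu cinner_self[of u] by auto
  moreover have "orthonormal (insert u G)"
    using G(2) ou nu by (rule orthonormal_insert_iff)
  moreover have "v \<in> cspan (insert u G)"
  proof -
    have "v = p + scaleC (of_real (norm (v - p))) u"
      using ne by (simp add: u_def scaleC_of_real)
    moreover have "p \<in> cspan (insert u G)"
      using p complex_vector.span_mono[of G "insert u G"] by blast
    moreover have "u \<in> cspan (insert u G)" by (simp add: complex_vector.span_base)
    ultimately show ?thesis by (metis complex_vector.span_add complex_vector.span_scale)
  qed
  moreover have "u \<in> cspan (insert v G)"
  proof -
    have "p \<in> cspan (insert v G)"
      using p complex_vector.span_mono[of G "insert v G"] by blast
    then show ?thesis unfolding u_def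
      by (intro complex_vector.span_scale complex_vector.span_diff) (simp_all add: complex_vector.span_base)
  qed
  ultimately show thesis by (rule that)
qed

lemma gram_schmidt:
  fixes M :: "'a::complex_inner set"
  assumes M: "complex_vector.subspace M" and W: "finite W" "W \<subseteq> M"
    and G: "finite G" "orthonormal G" "G \<subseteq> M"
  obtains G' where "finite G'" "orthonormal G'" "G \<subseteq> G'" "G' \<subseteq> M" "W \<subseteq> cspan G'"
  using W
proof (induction W arbitrary: thesis)
  case empty
  then show ?case using G by blast
next
  case (insert v W)
  then obtain G' where G': "finite G'" "orthonormal G'" "G \<subseteq> G'" "G' \<subseteq> M" "W \<subseteq> cspan G'"
    by auto
  show ?case
  proof (cases "v \<in> cspan G'")
    case True
    then show ?thesis using G' insert.prems(1) by blast
  next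
    case False
    from gram_schmidt_step[OF G'(1,2) False] obtain u where
      u: "u \<notin> G'" "orthonormal (insert u G')" "v \<in> cspan (insert u G')" "u \<in> cspan (insert v G')"
      by blast
    have "cspan (insert v G') \<subseteq> M"
      using insert.prems G'(4) by (intro complex_vector.span_minimal M) auto
    moreover have "W \<subseteq> cspan (insert u G')"
      using G'(5) complex_vector.span_mono[of G' "insert u G'"] by blast
    ultimately show ?thesis
      using u G' by (intro insert.prems(1)[of "insert u G'"]) auto
  qed
qed

section \<open>Orthogonal projections and orthonormal bases\<close>

text \<open>First-order optimality: after division by t, letting t tend to 0 kills the quadratic
  term, and t = a / (2 b) already gives the contradiction. It serves both the nearest point of a
  subspace and the unit vector maximising \<open>norm (A x)\<close>.\<close>

lemma linear_le_quadratic: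
  fixes a b :: real
  assumes "\<And>t. t > 0 \<Longrightarrow> t * a \<le> t\<^sup>2 * b"
  shows "a \<le> 0"
proof (rule ccontr)
  assume "\<not> a \<le> 0"
  then have a: "a > 0" by simp
  with assms[of 1] have b: "b > 0" by simp
  have "a / (2 * b) * a \<le> (a / (2 * b))\<^sup>2 * b"
    using a b by (intro assms) simp
  then show False using a b by (simp add: field_simps power2_eq_square)
qed

text \<open>A minimising sequence is Cauchy by the parallelogram law, because midpoints stay in S
  and so have distance at least d from x. The limit is taken in \<open>closure S\<close>, so the
  lemma applies directly to linear spans.\<close>

lemma orthogonal_projection_closure:
  fixes S :: "'a::complex_hilbert set"
  assumes S: "complex_vector.subspace S"
  obtains p where "p \<in> closure S" "\<And>s. s \<in> S \<Longrightarrow> cinner (x - p) s = 0"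
proof -
  define d where "d = infdist x S"
  define r where "r n = inverse (real (Suc n))" for n
  have ne: "S \<noteq> {}" using complex_vector.subspace_0[OF S] by blast
  have d0: "d \<ge> 0" by (simp add: d_def infdist_nonneg)
  have dle: "d \<le> norm (x - s)" if "s \<in> S" for s
    using infdist_le[OF that, of x] by (simp add: d_def dist_norm)
  have scR: "c *\<^sub>R s \<in> S" if "s \<in> S" for c s
    using complex_vector.subspace_scale[OF S that, of "of_real c"] by (simp add: scaleC_of_real)
  have "\<exists>s\<in>S. norm (x - s) < d + r n" for n
  proof (rule ccontr)
    assume "\<not> ?thesis"
    then have "d + r n \<le> dist x s" if "s \<in> S" for s using that by (auto simp: dist_norm)
    then have "d + r n \<le> infdist x S"
      unfolding infdist_notempty[OF ne] by (intro cINF_greatest ne)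
    then show False by (simp add: d_def r_def)
  qed
  then obtain y where y: "\<And>n. y n \<in> S" "\<And>n. norm (x - y n) < d + r n" by metis
  have rlim: "r \<longlonglongrightarrow> 0" unfolding r_def by (rule LIMSEQ_inverse_real_of_nat)
  define g where "g n = 4 * ((d + r n)\<^sup>2 - d\<^sup>2)" for n
  have g: "g \<longlonglongrightarrow> 0"
    unfolding g_def by (rule tendsto_eq_intros rlim refl)+ simp
  have key: "(norm (y m - y n))\<^sup>2 \<le> (g m + g n) / 2" for m n
  proof -
    have "(1/2) *\<^sub>R (y m + y n) \<in> S"
      using scR[OF complex_vector.subspace_add[OF S y(1) y(1)]] .
    then have "d \<le> norm (x - (1/2) *\<^sub>R (y m + y n))" by (rule dle)
    then have 1: "d\<^sup>2 \<le> (norm (x - (1/2) *\<^sub>R (y m + y n)))\<^sup>2" using d0 by (intro power_mono)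
    have 2: "(norm (x - y k))\<^sup>2 \<le> (d + r k)\<^sup>2" for k
      using y(2)[of k] by (intro power_mono) auto
    have 3: "(norm (y m - y n))\<^sup>2 + 4 * (norm (x - (1/2) *\<^sub>R (y m + y n)))\<^sup>2
        = 2 * (norm (x - y m))\<^sup>2 + 2 * (norm (x - y n))\<^sup>2"
      unfolding power2_norm_eq_inner
      by (simp only: inner_diff_left inner_diff_right inner_add_left inner_add_right
          inner_scaleR_left inner_scaleR_right) (simp add: inner_commute field_simps)
    have "l \<le> (4 * (a - c) + 4 * (b - c)) / 2"
      if "c \<le> h" "a' \<le> a" "b' \<le> b" "l + 4 * h = 2 * a' + 2 * b'" for a b c h l a' b' :: real
      using that by (simp add: field_simps)
    from this[OF 1 2 2 3] show ?thesis unfolding g_def .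
  qed
  have "Cauchy y"
  proof (rule CauchyI)
    fix e :: real assume e: "e > 0"
    then have "eventually (\<lambda>n. g n < e\<^sup>2) sequentially"
      using order_tendstoD(2)[OF g, of "e\<^sup>2"] by simp
    then obtain N where "\<forall>n\<ge>N. g n < e\<^sup>2" unfolding eventually_sequentially by blast
    then have N: "\<And>n. n \<ge> N \<Longrightarrow> g n < e\<^sup>2" by blast
    have "norm (y m - y n) < e" if "m \<ge> N" "n \<ge> N" for m n
    proof -
      have "(g m + g n) / 2 < e\<^sup>2" using N[OF that(1)] N[OF that(2)] by (simp add: field_simps)
      with key have "(norm (y m - y n))\<^sup>2 < e\<^sup>2" by (rule order.strict_trans1)
      then show ?thesis using e by (rule power2_less_imp_less[OF _ less_imp_le])
    qed
    then show "\<exists>M. \<forall>m\<ge>M. \<forall>n\<ge>M. norm (y m - y n) < e" by blast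
  qed
  then have "convergent y" by (rule Cauchy_convergent)
  then obtain p where p: "y \<longlonglongrightarrow> p" unfolding convergent_def by blast
  have "p \<in> closure S" unfolding closure_sequential using y(1) p by (intro exI[of _ y]) simp
  have pd: "norm (x - p) \<le> d"
  proof (rule LIMSEQ_le)
    show "(\<lambda>n. norm (x - y n)) \<longlonglongrightarrow> norm (x - p)" by (intro tendsto_intros p)
    show "(\<lambda>n. d + r n) \<longlonglongrightarrow> d" using tendsto_add[OF tendsto_const rlim, of d] by simp
    show "\<exists>N. \<forall>n\<ge>N. norm (x - y n) \<le> d + r n"
      by (intro exI[of _ 0] allI impI less_imp_le y(2))
  qed
  have dp: "d \<le> norm (x - (p + z))" if "z \<in> S" for z
  proof (rule LIMSEQ_le_const)
    show "(\<lambda>n. norm (x - (y n + z))) \<longlonglongrightarrow> norm (x - (p + z))" by (intro tendsto_intros p)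
    show "\<exists>N. \<forall>n\<ge>N. d \<le> norm (x - (y n + z))"
      by (intro exI[of _ 0] allI impI dle complex_vector.subspace_add[OF S y(1) that])
  qed
  have re: "Re (cinner (x - p) z) \<le> 0" if z: "z \<in> S" for z
  proof -
    have "2 * Re (cinner (x - p) z) \<le> 0"
    proof (rule linear_le_quadratic)
      fix t :: real assume "t > 0"
      have "norm (x - p) \<le> norm (x - (p + t *\<^sub>R z))" using pd dp[OF scR[OF z, of t]] by linarith
      then have "(norm (x - p))\<^sup>2 \<le> (norm ((x - p) + (- t) *\<^sub>R z))\<^sup>2"
        by (intro power_mono) (simp_all add: algebra_simps)
      then show "t * (2 * Re (cinner (x - p) z)) \<le> t\<^sup>2 * (norm z)\<^sup>2"
        unfolding norm_sq_add by (simp add: cinner.scaleR_right cinner.minus_right power_mult_distrib)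
    qed
    then show ?thesis by simp
  qed
  \<comment> \<open>The one-sided inequality at -z gives equality for the real part; the same at i z
    then gives the imaginary part.\<close>
  have re0: "Re (cinner (x - p) z) = 0" if z: "z \<in> S" for z
    using re[OF z] re[OF scR[OF z, of "-1"]] by (simp add: cinner.minus_right)
  have "cinner (x - p) s = 0" if s: "s \<in> S" for s
    using re0[OF s] re0[OF complex_vector.subspace_scale[OF S s, of \<i>]]
    by (simp add: complex_eq_iff cinner_scaleC_right)
  with \<open>p \<in> closure S\<close> show thesis by (rule that)
qed

lemma csubspace_closure:
  assumes "complex_vector.subspace S"
  shows "complex_vector.subspace (closure S)"
proof -
  have 0: "0 \<in> closure S"
    using complex_vector.subspace_0[OF assms] closure_subset by blast
  have add: "x + y \<in> closure S" if xy: "x \<in> closure S" "y \<in> closure S" for x y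
  proof -
    obtain f g where "\<And>n. f n \<in> S" "f \<longlonglongrightarrow> x" "\<And>n. g n \<in> S" "g \<longlonglongrightarrow> y"
      using xy unfolding closure_sequential by blast
    then show ?thesis unfolding closure_sequential
      by (intro exI[of _ "\<lambda>n. f n + g n"]) (simp add: tendsto_add complex_vector.subspace_add[OF assms])
  qed
  have "scaleC c x \<in> closure S" if x: "x \<in> closure S" for c x
  proof -
    obtain f where "\<forall>n. f n \<in> S" "f \<longlonglongrightarrow> x"
      using x unfolding closure_sequential by blast
    then show ?thesis unfolding closure_sequential
      by (intro exI[of _ "\<lambda>n. scaleC c (f n)"])
        (simp add: scaleC.tendsto complex_vector.subspace_scale[OF assms])
  qed
  with 0 add show ?thesis unfolding complex_vector.subspace_def by blast
qed

lemma orthonormal_basis_subspace: "orthonormal_basis M E \<Longrightarrow> complex_vector.subspace M"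
  unfolding orthonormal_basis_iff
  using csubspace_closure[OF complex_vector.subspace_span] by blast

lemma orthonormal_basis_mem: "orthonormal_basis M E \<Longrightarrow> e \<in> E \<Longrightarrow> e \<in> M"
  unfolding orthonormal_basis_iff using complex_vector.span_base closure_subset by blast

lemma orthonormal_basis_orthogonal_eq_0:
  assumes "orthonormal_basis M E" "x \<in> M" "\<And>e. e \<in> E \<Longrightarrow> cinner x e = 0"
  shows "x = 0"
  using cinner_closure_cspan_eq_0[of E x x] assms cinner_self[of x]
  by (simp add: orthonormal_basis_iff)

text \<open>A vector of M minus its projection on the closed span of E is orthogonal to E, so
  \<open>max\<close> annihilates it and the span is dense in M.\<close>

lemma orthonormal_basisI:
  fixes M :: "'a::complex_hilbert set"
  assumes M: "closed M" "complex_vector.subspace M" and E: "orthonormal E" "E \<subseteq> M"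
    and max: "\<And>z. z \<in> M \<Longrightarrow> (\<And>e. e \<in> E \<Longrightarrow> cinner z e = 0) \<Longrightarrow> z = 0"
  shows "orthonormal_basis M E"
proof -
  have sub: "closure (cspan E) \<subseteq> M"
    by (intro closure_minimal complex_vector.span_minimal M E)
  have "x \<in> closure (cspan E)" if x: "x \<in> M" for x
  proof -
    obtain p where p: "p \<in> closure (cspan E)" "\<And>s. s \<in> cspan E \<Longrightarrow> cinner (x - p) s = 0"
      using orthogonal_projection_closure[OF complex_vector.subspace_span] by metis
    have "x - p = 0"
      using p x sub by (intro max complex_vector.subspace_diff[OF M(2)]) (auto simp: complex_vector.span_base)
    then show ?thesis using p by simp
  qed
  with sub E(1) show ?thesis unfolding orthonormal_basis_iff by blast
qed

lemma orthonormal_basis_extend: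
  fixes M :: "'a::complex_hilbert set"
  assumes M: "closed M" "complex_vector.subspace M" and G: "orthonormal G" "G \<subseteq> M"
  obtains E where "orthonormal_basis M E" "G \<subseteq> E"
proof -
  define \<A> where "\<A> = {E. orthonormal E \<and> G \<subseteq> E \<and> E \<subseteq> M}"
  have "\<exists>E\<in>\<A>. \<forall>X\<in>\<A>. E \<subseteq> X \<longrightarrow> X = E"
  proof (rule subset_Zorn_nonempty)
    show "\<A> \<noteq> {}" using G by (auto simp: \<A>_def)
    fix C assume C: "C \<noteq> {}" "subset.chain \<A> C"
    have "cinner x y = (if x = y then 1 else 0)" if xy: "x \<in> \<Union>C" "y \<in> \<Union>C" for x y
    proof -
      obtain X Y where XY: "X \<in> C" "Y \<in> C" "x \<in> X" "y \<in> Y" using xy by blast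
      then have "X \<subseteq> Y \<or> Y \<subseteq> X" using C(2) by (auto simp: subset.chain_def)
      then obtain Z where Z: "Z \<in> C" "x \<in> Z" "y \<in> Z" using XY by blast
      then have "orthonormal Z" using C(2) by (auto simp: subset.chain_def \<A>_def)
      then show ?thesis using Z(2,3) by (rule orthonormal_cinner)
    qed
    then have "orthonormal (\<Union>C)" unfolding orthonormal_def by blast
    moreover have "C \<subseteq> \<A>" using C(2) by (simp add: subset.chain_def)
    then have "G \<subseteq> \<Union>C" "\<Union>C \<subseteq> M" using C(1) unfolding \<A>_def by blast+
    ultimately show "\<Union>C \<in> \<A>" by (simp add: \<A>_def)
  qed
  then obtain E where E: "E \<in> \<A>" "\<And>X. X \<in> \<A> \<Longrightarrow> E \<subseteq> X \<Longrightarrow> X = E" by blast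
  have "orthonormal_basis M E"
  proof (rule orthonormal_basisI)
    fix z assume z: "z \<in> M" "\<And>e. e \<in> E \<Longrightarrow> cinner z e = 0"
    show "z = 0"
    proof (rule ccontr)
      assume z0: "z \<noteq> 0"
      define u where "u = scaleC (of_real (inverse (norm z))) z"
      have nu: "norm u = 1" using z0 by (simp add: u_def norm_scaleC norm_inverse)
      have uo: "cinner u e = 0" if "e \<in> E" for e
        using z(2)[OF that] by (simp add: u_def cinner_scaleC_left)
      have "u \<in> M" unfolding u_def using z(1) by (rule complex_vector.subspace_scale[OF M(2)])
      then have "insert u E \<in> \<A>"
        using E(1) orthonormal_insert_iff[OF _ uo nu, of E] by (auto simp: \<A>_def)
      then have "insert u E = E" by (rule E(2)) auto
      then have "cinner u u = 0" using uo by blast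
      then show False using nu cinner_self[of u] by simp
    qed
  qed (use M E(1) in \<open>auto simp: \<A>_def\<close>)
  with E(1) show thesis by (intro that) (auto simp: \<A>_def)
qed

lemma closed_corthogonal: "closed (corthogonal M)"
proof -
  have "corthogonal M = (\<Inter>y\<in>M. {x. cinner x y = 0})" by (auto simp: corthogonal_def)
  moreover have "closed {x. cinner x y = 0}" for y :: 'a
    by (intro closed_Collect_eq continuous_on_const
        bounded_linear.continuous_on[OF cinner.bounded_linear_left] continuous_on_id)
  ultimately show ?thesis by auto
qed

lemma subspace_corthogonal: "complex_vector.subspace (corthogonal M)"
  by (auto simp: complex_vector.subspace_def corthogonal_def cinner.zero_left
      cinner.add_left cinner_scaleC_left)

lemma bounded_clinear_ker:
  assumes "bounded_clinear T"
  shows "closed (ker T)" "complex_vector.subspace (ker T)"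
proof -
  interpret bounded_linear T using assms by (simp add: bounded_clinear_def)
  show "closed (ker T)" unfolding ker_def
    by (intro closed_Collect_eq continuous_on_const continuous_on continuous_on_id)
  show "complex_vector.subspace (ker T)"
    using assms by (auto simp: complex_vector.subspace_def ker_def zero add bounded_clinear_def)
qed

text \<open>A point of \<open>cspan E\<close> near x involves finitely many basis vectors, and the
  Fourier sum over these is at least as close; Bessel's identity turns the distance into the missing
  part of the norm.\<close>

lemma parseval_approx:
  assumes E: "orthonormal_basis M E" and x: "x \<in> M" and eps: "\<epsilon> > 0"
  obtains F where "finite F" "F \<subseteq> E" "(norm x)\<^sup>2 - \<epsilon> < (\<Sum>e\<in>F. (cmod (cinner x e))\<^sup>2)"
proof -
  have "x \<in> closure (cspan E)" using E x by (simp add: orthonormal_basis_iff)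
  then obtain y where y: "y \<in> cspan E" "dist y x < sqrt \<epsilon>"
    using eps unfolding closure_approachable by (metis real_sqrt_gt_zero)
  obtain F where F: "finite F" "F \<subseteq> E" "y \<in> cspan F" using y(1) by (rule cspan_finite_subset)
  have oF: "orthonormal F" using E F(2) orthonormal_subset by (auto simp: orthonormal_basis_iff)
  have "norm (x - (\<Sum>e\<in>F. scaleC (cinner x e) e)) < sqrt \<epsilon>"
    using best_approximation[OF F(1) oF F(3), of x] y(2) by (simp add: dist_norm norm_minus_commute)
  then have "(norm (x - (\<Sum>e\<in>F. scaleC (cinner x e) e)))\<^sup>2 < (sqrt \<epsilon>)\<^sup>2"
    by (intro power_strict_mono) auto
  then have "(norm x)\<^sup>2 - \<epsilon> < (\<Sum>e\<in>F. (cmod (cinner x e))\<^sup>2)"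
    using eps unfolding bessel_diff[OF F(1) oF] by simp
  with F(1,2) show thesis by (rule that)
qed

section \<open>Hilbert-Schmidt sums and finite singular systems\<close>

lemma bounded_clinear_cinner:
  assumes "bounded_clinear K"
  shows "bounded_linear (\<lambda>x. cinner (K x) y)"
    and "cinner (K (scaleC a x)) y = a * cinner (K x) y"
proof -
  have "bounded_linear K" using assms by (simp add: bounded_clinear_def)
  then show "bounded_linear (\<lambda>x. cinner (K x) y)"
    by (rule bounded_linear_compose[OF cinner.bounded_linear_left])
  show "cinner (K (scaleC a x)) y = a * cinner (K x) y"
    using assms by (simp add: bounded_clinear_def cinner_scaleC_left)
qed

text \<open>Cauchy-Schwarz on the finite expansion of a vector in the span, then closedness of the
  inequality. Together with \<open>sum_functional_le\<close> this carries square sums of a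
  functional from a basis to any finite orthonormal set.\<close>

lemma functional_bound:
  fixes \<phi> :: "'a::complex_inner \<Rightarrow> complex"
  assumes F: "orthonormal_basis M F"
    and \<phi>: "bounded_linear \<phi>" "\<And>a x. \<phi> (scaleC a x) = a * \<phi> x"
    and S: "\<And>F'. finite F' \<Longrightarrow> F' \<subseteq> F \<Longrightarrow> (\<Sum>f\<in>F'. (cmod (\<phi> f))\<^sup>2) \<le> S"
    and x: "x \<in> M"
  shows "(cmod (\<phi> x))\<^sup>2 \<le> S * (norm x)\<^sup>2"
proof -
  interpret \<phi>: bounded_linear \<phi> by (rule \<phi>)
  have "closed {x. (cmod (\<phi> x))\<^sup>2 \<le> S * (norm x)\<^sup>2}"
    by (intro closed_Collect_le continuous_intros \<phi>.continuous_on)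
  moreover have "cspan F \<subseteq> {x. (cmod (\<phi> x))\<^sup>2 \<le> S * (norm x)\<^sup>2}"
  proof
    fix y assume "y \<in> cspan F"
    then obtain F' where F': "finite F'" "F' \<subseteq> F" "y \<in> cspan F'" by (rule cspan_finite_subset)
    have o: "orthonormal F'" using F F'(2) orthonormal_subset by (auto simp: orthonormal_basis_iff)
    have "\<phi> y = \<phi> (\<Sum>f\<in>F'. scaleC (cinner y f) f)"
      using orthonormal_expansion[OF F'(1) o F'(3)] by simp
    also have "\<dots> = (\<Sum>f\<in>F'. cinner y f * \<phi> f)" by (simp add: \<phi>.sum \<phi>(2))
    finally have "cmod (\<phi> y) \<le> (\<Sum>f\<in>F'. cmod (cinner y f) * cmod (\<phi> f))"
      by (simp add: norm_mult[symmetric] norm_sum)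
    then have "(cmod (\<phi> y))\<^sup>2 \<le> (\<Sum>f\<in>F'. cmod (cinner y f) * cmod (\<phi> f))\<^sup>2"
      by (intro power_mono) auto
    also have "\<dots> \<le> (\<Sum>f\<in>F'. (cmod (cinner y f))\<^sup>2) * (\<Sum>f\<in>F'. (cmod (\<phi> f))\<^sup>2)"
      by (rule Cauchy_Schwarz_ineq_sum)
    also have "\<dots> = (norm y)\<^sup>2 * (\<Sum>f\<in>F'. (cmod (\<phi> f))\<^sup>2)"
      unfolding parseval_finite[OF F'(1) o F'(3)] ..
    also have "\<dots> \<le> (norm y)\<^sup>2 * S"
      by (rule mult_left_mono[OF S[OF F'(1,2)]]) simp
    finally show "y \<in> {x. (cmod (\<phi> x))\<^sup>2 \<le> S * (norm x)\<^sup>2}" by (simp add: mult.commute)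
  qed
  ultimately have "closure (cspan F) \<subseteq> {x. (cmod (\<phi> x))\<^sup>2 \<le> S * (norm x)\<^sup>2}"
    by (intro closure_minimal)
  then show ?thesis using x F by (auto simp: orthonormal_basis_iff)
qed

text \<open>The functional is tested on its own Riesz vector relative to \<open>E\<close>.\<close>

lemma sum_functional_le:
  fixes \<phi> :: "'a::complex_inner \<Rightarrow> complex"
  assumes \<phi>: "bounded_linear \<phi>" "\<And>a x. \<phi> (scaleC a x) = a * \<phi> x"
    and M: "complex_vector.subspace M"
    and S: "\<And>x. x \<in> M \<Longrightarrow> (cmod (\<phi> x))\<^sup>2 \<le> S * (norm x)\<^sup>2" "S \<ge> 0"
    and E: "finite E" "orthonormal E" "E \<subseteq> M"
  shows "(\<Sum>e\<in>E. (cmod (\<phi> e))\<^sup>2) \<le> S"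
proof -
  interpret \<phi>: bounded_linear \<phi> by (rule \<phi>)
  define w where "w = (\<Sum>e\<in>E. scaleC (cnj (\<phi> e)) e)"
  define q where "q = (\<Sum>e\<in>E. (cmod (\<phi> e))\<^sup>2)"
  have "w \<in> M" unfolding w_def
    using E(3) by (intro complex_vector.subspace_sum[OF M] complex_vector.subspace_scale[OF M]) auto
  then have le: "(cmod (\<phi> w))\<^sup>2 \<le> S * (norm w)\<^sup>2" by (rule S)
  have "\<phi> w = (\<Sum>e\<in>E. of_real ((cmod (\<phi> e))\<^sup>2))"
    unfolding w_def \<phi>.sum \<phi>(2) by (simp only: complex_norm_square mult.commute)
  then have "\<phi> w = of_real q" by (simp add: q_def)
  moreover have "(norm w)\<^sup>2 = q"
    unfolding w_def norm_sq_sum_orthonormal[OF E(1,2)] q_def by simp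
  ultimately have "q * q \<le> S * q" using le by (simp add: power2_eq_square)
  moreover have "q \<ge> 0" by (simp add: q_def sum_nonneg)
  ultimately have "q \<le> S" using S(2) by (cases "q = 0") auto
  then show ?thesis by (simp add: q_def)
qed

lemma has_sum_finite_sum:
  fixes f :: "'b \<Rightarrow> 'c \<Rightarrow> real"
  assumes "finite G" "\<And>g. g \<in> G \<Longrightarrow> (f g has_sum s g) E"
  shows "((\<lambda>e. \<Sum>g\<in>G. f g e) has_sum (\<Sum>g\<in>G. s g)) E"
  using assms by (induction rule: finite_induct) (simp_all add: has_sum_add)

lemma summable_on_cmod_cinner_sq:
  fixes K :: "'b \<Rightarrow> 'a::complex_inner"
  assumes K: "(\<lambda>e. (norm (K e))\<^sup>2) summable_on E"
  shows "(\<lambda>e. (cmod (cinner (K e) g))\<^sup>2) summable_on E"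
proof (rule summable_on_comparison_test)
  show "(\<lambda>e. (norm (K e))\<^sup>2 * (norm g)\<^sup>2) summable_on E"
    using K by (rule summable_on_cmult_left)
  show "(cmod (cinner (K e) g))\<^sup>2 \<le> (norm (K e))\<^sup>2 * (norm g)\<^sup>2" for e
    using power_mono[OF cauchy_schwarz_cinner[of "K e" g], of 2] by (simp add: power_mult_distrib)
qed simp

lemma infsum_bessel:
  fixes K :: "'b \<Rightarrow> 'a::complex_inner"
  assumes K: "(\<lambda>e. (norm (K e))\<^sup>2) summable_on E" and G: "finite G" "orthonormal G"
  shows "(\<Sum>g\<in>G. infsum (\<lambda>e. (cmod (cinner (K e) g))\<^sup>2) E) \<le> infsum (\<lambda>e. (norm (K e))\<^sup>2) E"
proof -
  have "((\<lambda>e. \<Sum>g\<in>G. (cmod (cinner (K e) g))\<^sup>2) has_sum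
      (\<Sum>g\<in>G. infsum (\<lambda>e. (cmod (cinner (K e) g))\<^sup>2) E)) E"
    by (intro has_sum_finite_sum G(1) has_sum_infsum summable_on_cmod_cinner_sq K)
  then show "(\<Sum>g\<in>G. infsum (\<lambda>e. (cmod (cinner (K e) g))\<^sup>2) E) \<le> infsum (\<lambda>e. (norm (K e))\<^sup>2) E"
    by (rule has_sum_mono[OF _ has_sum_infsum[OF K]]) (rule bessel_le[OF G])
qed

lemma functional_bound_infsum:
  assumes F: "orthonormal_basis M F" and K: "bounded_clinear K"
    and sm: "(\<lambda>f. (norm (K f))\<^sup>2) summable_on F" and x: "x \<in> M"
  shows "(cmod (cinner (K x) y))\<^sup>2 \<le> infsum (\<lambda>f. (cmod (cinner (K f) y))\<^sup>2) F * (norm x)\<^sup>2"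
proof (rule functional_bound[OF F bounded_clinear_cinner[OF K] _ x])
  fix F' assume "finite F'" "F' \<subseteq> F"
  moreover have "(\<lambda>f. (cmod (cinner (K f) y))\<^sup>2) summable_on F"
    using sm by (rule summable_on_cmod_cinner_sq)
  ultimately show "(\<Sum>f\<in>F'. (cmod (cinner (K f) y))\<^sup>2) \<le> infsum (\<lambda>f. (cmod (cinner (K f) y))\<^sup>2) F"
    by (intro finite_sum_le_infsum) auto
qed

text \<open>This supplies the independence from the basis that the existential in
  \<open>hilbert_schmidt_on\<close> leaves open. The vectors \<open>K e\<close> lie in the span of a
  finite orthonormal H, so their norms split into the functionals (Kx, h); each of these passes from
  F to E, and Bessel's inequality recombines them on the side of F.\<close>

lemma sum_norm_sq_le_hilbert_schmidt:
  assumes F: "orthonormal_basis M F" and K: "bounded_clinear K"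
    and sm: "(\<lambda>f. (norm (K f))\<^sup>2) summable_on F"
    and E: "finite E" "orthonormal E" "E \<subseteq> M"
  shows "(\<Sum>e\<in>E. (norm (K e))\<^sup>2) \<le> infsum (\<lambda>f. (norm (K f))\<^sup>2) F"
proof -
  obtain H where H: "finite H" "orthonormal H" "K ` E \<subseteq> cspan H"
    using gram_schmidt[of UNIV "K ` E" "{}"] E(1) by (auto simp: orthonormal_def)
  define S where "S h = infsum (\<lambda>f. (cmod (cinner (K f) h))\<^sup>2) F" for h
  have "(\<Sum>e\<in>E. (norm (K e))\<^sup>2) = (\<Sum>e\<in>E. \<Sum>h\<in>H. (cmod (cinner (K e) h))\<^sup>2)"
    using H by (intro sum.cong refl parseval_finite[symmetric]) auto
  also have "\<dots> = (\<Sum>h\<in>H. \<Sum>e\<in>E. (cmod (cinner (K e) h))\<^sup>2)" by (rule sum.swap)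
  also have "\<dots> \<le> (\<Sum>h\<in>H. S h)"
  proof (rule sum_mono)
    fix h
    show "(\<Sum>e\<in>E. (cmod (cinner (K e) h))\<^sup>2) \<le> S h"
      unfolding S_def
      by (rule sum_functional_le[OF bounded_clinear_cinner[OF K] orthonormal_basis_subspace[OF F]
            functional_bound_infsum[OF F K sm] infsum_nonneg E]) auto
  qed
  also have "\<dots> \<le> infsum (\<lambda>f. (norm (K f))\<^sup>2) F"
    unfolding S_def by (rule infsum_bessel[OF sm H(1,2)])
  finally show ?thesis .
qed

section \<open>Singular systems on finite-dimensional subspaces\<close>

text \<open>The ambient space is not locally compact in general, so compactness is built from
  coefficients: \<open>Z E\<close> is the image of a polydisc, compact by adding one disc at a time,
  and by Cauchy-Schwarz it contains every unit vector of the span.\<close>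

lemma compact_unit_sphere_cspan:
  assumes "finite E" "orthonormal E"
  shows "compact {x \<in> cspan E. norm x = 1}"
proof -
  define Z where "Z E = {x. \<exists>c. (\<forall>e\<in>E. cmod (c e) \<le> 1) \<and> x = (\<Sum>e\<in>E. scaleC (c e) e)}"
    for E :: "'a set"
  have "compact (Z E)" using assms(1)
  proof (induction rule: finite_induct)
    case empty
    then show ?case by (simp add: Z_def)
  next
    case (insert e E)
    have "Z (insert e E) = {x + y |x y. x \<in> (\<lambda>c. scaleC c e) ` cball 0 1 \<and> y \<in> Z E}"
    proof (intro set_eqI iffI)
      fix x assume "x \<in> Z (insert e E)"
      then obtain c where c: "\<forall>f\<in>insert e E. cmod (c f) \<le> 1"
        "x = (\<Sum>f\<in>insert e E. scaleC (c f) f)" by (auto simp only: Z_def mem_Collect_eq)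
      have "x = scaleC (c e) e + (\<Sum>f\<in>E. scaleC (c f) f)" using c(2) insert.hyps by simp
      moreover have "scaleC (c e) e \<in> (\<lambda>c. scaleC c e) ` cball 0 1" using c(1) by (intro imageI) simp
      moreover have "(\<Sum>f\<in>E. scaleC (c f) f) \<in> Z E" using c(1) by (auto simp: Z_def)
      ultimately show "x \<in> {x + y |x y. x \<in> (\<lambda>c. scaleC c e) ` cball 0 1 \<and> y \<in> Z E}"
        by blast
    next
      fix x assume "x \<in> {x + y |x y. x \<in> (\<lambda>c. scaleC c e) ` cball 0 1 \<and> y \<in> Z E}"
      then obtain b c where bc: "cmod b \<le> 1" "\<forall>e\<in>E. cmod (c e) \<le> 1"
        "x = scaleC b e + (\<Sum>e\<in>E. scaleC (c e) e)" by (auto simp: Z_def)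
      have "(\<Sum>f\<in>E. scaleC ((c(e := b)) f) f) = (\<Sum>e\<in>E. scaleC (c e) e)"
        using insert.hyps by (intro sum.cong) auto
      then show "x \<in> Z (insert e E)"
        using bc insert.hyps by (auto simp: Z_def intro!: exI[of _ "c(e := b)"])
    qed
    moreover have "compact ((\<lambda>c. scaleC c e) ` cball 0 1)" for e :: 'a
      by (intro compact_continuous_image compact_cball
          bounded_linear.continuous_on[OF scaleC.bounded_linear_left] continuous_on_id)
    ultimately show ?case using compact_sums[OF _ insert.IH] by simp
  qed
  moreover have "{x \<in> cspan E. norm x = 1} = Z E \<inter> sphere 0 1"
  proof (intro set_eqI iffI)
    fix x assume "x \<in> {x \<in> cspan E. norm x = 1}"
    then have x: "x \<in> cspan E" "norm x = 1" by auto
    have "cmod (cinner x e) \<le> 1" if "e \<in> E" for e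
      using cauchy_schwarz_cinner[of x e] x(2) orthonormal_norm[OF assms(2) that] by simp
    then show "x \<in> Z E \<inter> sphere 0 1"
      using x orthonormal_expansion[OF assms x(1)] by (auto simp: Z_def intro!: exI[of _ "cinner x"])
  next
    fix x assume x: "x \<in> Z E \<inter> sphere 0 1"
    then obtain c where c: "x = (\<Sum>e\<in>E. scaleC (c e) e)" by (auto simp: Z_def)
    have "x \<in> cspan E" unfolding c
      by (intro complex_vector.span_sum complex_vector.span_scale complex_vector.span_base)
    with x show "x \<in> {x \<in> cspan E. norm x = 1}" by auto
  qed
  moreover have "closed (sphere (0::'a) 1)"
    unfolding sphere_def by (intro closed_Collect_eq continuous_intros)
  ultimately show ?thesis by (simp add: compact_Int_closed)
qed

text \<open>A maximiser is a top singular vector of A on V; the orthogonality of the images is the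
  vanishing of the first variation in the direction z.\<close>

lemma maximizer_orthogonal_images:
  assumes A: "bounded_clinear A" and V: "complex_vector.subspace V"
    and x: "x \<in> V" "norm x = 1"
    and max: "\<And>y. y \<in> V \<Longrightarrow> norm y = 1 \<Longrightarrow> norm (A y) \<le> norm (A x)"
    and z: "z \<in> V" "cinner x z = 0"
  shows "cinner (A x) (A z) = 0"
proof -
  interpret A: bounded_linear A using A by (simp add: bounded_clinear_def)
  have AC: "A (scaleC a y) = scaleC a (A y)" for a y using A by (simp add: bounded_clinear_def)
  have bound: "(norm (A y))\<^sup>2 \<le> (norm (A x))\<^sup>2 * (norm y)\<^sup>2" if y: "y \<in> V" for y
  proof (cases "y = 0")
    case True
    then show ?thesis by (simp add: A.zero)
  next
    case False
    have "norm (A ((1 / norm y) *\<^sub>R y)) \<le> norm (A x)"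
      using False complex_vector.subspace_scale[OF V y, of "of_real (1 / norm y)"]
      unfolding scaleC_of_real by (intro max) auto
    then have "norm (A y) \<le> norm (A x) * norm y"
      using False by (simp add: A.scaleR field_simps)
    then have "(norm (A y))\<^sup>2 \<le> (norm (A x) * norm y)\<^sup>2" by (intro power_mono) auto
    then show ?thesis by (simp add: power_mult_distrib)
  qed
  define b where "b = cinner (A x) (A z)"
  have "2 * (cmod b)\<^sup>2 \<le> 0"
  proof (rule linear_le_quadratic)
    fix t :: real assume "t > 0"
    \<comment> \<open>Aligning the perturbation with the phase of b makes the first-order term the
      real number 2 t |b|^2, while the norm of x + c z grows only to second order, x being
      orthogonal to z.\<close>
    define c where "c = of_real t * b"
    have "x + scaleC c z \<in> V"
      using x z by (intro complex_vector.subspace_add[OF V] complex_vector.subspace_scale[OF V])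
    then have le: "(norm (A x + scaleC c (A z)))\<^sup>2 \<le> (norm (A x))\<^sup>2 * (norm (x + scaleC c z))\<^sup>2"
      using bound[of "x + scaleC c z"] by (simp add: A.add AC)
    have re: "Re (cinner (A x) (scaleC c (A z))) = t * (cmod b)\<^sup>2"
      unfolding cmod_power2
      by (simp add: cinner_scaleC_right c_def b_def[symmetric] power2_eq_square algebra_simps)
    have n: "(norm (x + scaleC c z))\<^sup>2 = 1 + (t * cmod b)\<^sup>2 * (norm z)\<^sup>2"
      unfolding norm_sq_add using x z
      by (simp add: cinner_scaleC_right norm_scaleC c_def norm_mult power_mult_distrib)
    have "2 * (t * (cmod b)\<^sup>2) + (norm (scaleC c (A z)))\<^sup>2
      \<le> (norm (A x))\<^sup>2 * ((t * cmod b)\<^sup>2 * (norm z)\<^sup>2)"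
      using le unfolding n norm_sq_add[of "A x"] re by (simp add: algebra_simps)
    then have "2 * (t * (cmod b)\<^sup>2) \<le> (norm (A x))\<^sup>2 * ((t * cmod b)\<^sup>2 * (norm z)\<^sup>2)"
      by (rule order_trans[rotated]) simp
    then show "t * (2 * (cmod b)\<^sup>2) \<le> t\<^sup>2 * ((norm (A x))\<^sup>2 * ((cmod b)\<^sup>2 * (norm z)\<^sup>2))"
      by (simp add: power_mult_distrib algebra_simps)
  qed
  then show ?thesis by (simp add: b_def)
qed

text \<open>The Hilbert-Schmidt sum of the identity over a finite orthonormal set is its
  cardinality, so comparing the two sums compares dimensions.\<close>

lemma card_orthonormal_le:
  fixes E F :: "'a::complex_inner set"
  assumes "finite F" "orthonormal F" "finite E" "orthonormal E" "E \<subseteq> cspan F"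
  shows "card E \<le> card F"
proof -
  have "bounded_clinear (\<lambda>x::'a. x)" by (simp add: bounded_clinear_def)
  moreover have "orthonormal_basis (closure (cspan F)) F"
    using assms by (simp add: orthonormal_basis_iff)
  moreover have "E \<subseteq> closure (cspan F)" using assms(5) closure_subset by blast
  ultimately have "(\<Sum>e\<in>E. (norm e)\<^sup>2) \<le> infsum (\<lambda>f. (norm f)\<^sup>2) F"
    using assms by (intro sum_norm_sq_le_hilbert_schmidt) auto
  then have "(\<Sum>e\<in>E. (norm e)\<^sup>2) \<le> (\<Sum>f\<in>F. (norm f)\<^sup>2)" using assms(1) by simp
  moreover have "(\<Sum>e\<in>E. (norm e)\<^sup>2) = real (card E)" "(\<Sum>e\<in>F. (norm e)\<^sup>2) = real (card F)"
    using assms(2,4) by (simp_all add: orthonormal_norm)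
  ultimately show ?thesis by simp
qed

text \<open>A singular value decomposition of A on the span of E, found by peeling off maximisers:
  the image of a maximiser is orthogonal to the image of its orthogonal complement in the span, on
  which the argument is repeated.\<close>

lemma finite_singular_system:
  assumes A: "bounded_clinear A" and "finite E" "orthonormal E"
  obtains X where "finite X" "orthonormal X" "X \<subseteq> cspan E"
    "\<And>x z. x \<in> X \<Longrightarrow> z \<in> X \<Longrightarrow> x \<noteq> z \<Longrightarrow> cinner (A x) (A z) = 0"
    "(\<Sum>e\<in>E. (norm (A e))\<^sup>2) \<le> (\<Sum>x\<in>X. (norm (A x))\<^sup>2)"
  using assms(2,3)
proof (induction "card E" arbitrary: E thesis rule: less_induct)
  case less
  interpret A: bounded_linear A using A by (simp add: bounded_clinear_def)
  note E = less.prems(2,3)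
  show ?case
  proof (cases "E = {}")
    case True
    then show ?thesis by (intro less.prems(1)[of "{}"]) (auto simp: orthonormal_def)
  next
    case False
    define V where "V = cspan E"
    have V: "complex_vector.subspace V" by (simp add: V_def)
    obtain e0 where e0: "e0 \<in> E" using False by blast
    then have "e0 \<in> {x \<in> cspan E. norm x = 1}"
      using orthonormal_norm[OF E(2)] by (simp add: complex_vector.span_base)
    then have "{x \<in> cspan E. norm x = 1} \<noteq> {}" by blast
    moreover have "continuous_on {x \<in> cspan E. norm x = 1} (\<lambda>x. norm (A x))"
      by (intro continuous_intros A.continuous_on)
    ultimately obtain x where x: "x \<in> V" "norm x = 1"
      and max: "\<And>y. y \<in> V \<Longrightarrow> norm y = 1 \<Longrightarrow> norm (A y) \<le> norm (A x)"
      using continuous_attains_sup[OF compact_unit_sphere_cspan[OF E]] unfolding V_def by blast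
    have ox: "orthonormal {x}" using x(2) by (simp add: orthonormal_def cinner_self)
    obtain G where G: "finite G" "orthonormal G" "{x} \<subseteq> G" "G \<subseteq> V" "E \<subseteq> cspan G"
      by (rule gram_schmidt[OF V E(1), of "{x}"])
        (use x ox complex_vector.span_superset[of E] in \<open>auto simp: V_def\<close>)
    define G' where "G' = G - {x}"
    have G': "finite G'" "orthonormal G'" "G = insert x G'" "x \<notin> G'"
      using G orthonormal_subset[OF G(2), of G'] by (auto simp: G'_def)
    \<comment> \<open>Completing x to an orthonormal system inside the span of E takes at most
      \<open>card E\<close> vectors, so removing x makes the measure drop.\<close>
    have "card G \<le> card E" using card_orthonormal_le[OF E G(1,2)] G(4) by (simp add: V_def)
    then have "card G' < card E" using G' by simp
    from less.hyps[OF this _ G'(1,2)] obtain X where X: "finite X" "orthonormal X" "X \<subseteq> cspan G'"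
      "\<And>x z. x \<in> X \<Longrightarrow> z \<in> X \<Longrightarrow> x \<noteq> z \<Longrightarrow> cinner (A x) (A z) = 0"
      "(\<Sum>e\<in>G'. (norm (A e))\<^sup>2) \<le> (\<Sum>x\<in>X. (norm (A x))\<^sup>2)" by blast
    have xX: "cinner x z = 0" if "z \<in> X" for z
    proof (rule cinner_cspan_eq_0)
      show "z \<in> cspan G'" using that X(3) by blast
      show "cinner x s = 0" if "s \<in> G'" for s
        using orthonormal_cinner[OF G(2), of x s] that G' by auto
    qed
    have nX: "x \<notin> X" using xX[of x] x(2) by (auto simp: cinner_self)
    have "cspan G' \<subseteq> V"
      using G(4) G'(3) by (intro complex_vector.span_minimal V) auto
    then have XV: "X \<subseteq> V" using X(3) by blast
    have Ax: "cinner (A x) (A z) = 0" if "z \<in> X" for z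
      using maximizer_orthogonal_images[OF A V x max _ xX[OF that]] XV that by blast
    show ?thesis
    proof (rule less.prems(1)[of "insert x X"])
      show "orthonormal (insert x X)" by (rule orthonormal_insert_iff[OF X(2) xX x(2)])
      show "insert x X \<subseteq> cspan E" using x XV by (auto simp: V_def)
      show "cinner (A y) (A z) = 0" if "y \<in> insert x X" "z \<in> insert x X" "y \<noteq> z" for y z
        using that X(4)[of y z] Ax[of y] Ax[of z] cinner_eq_0_commute[of "A x" "A y"] by blast
      have "(\<Sum>e\<in>E. (norm (A e))\<^sup>2) \<le> infsum (\<lambda>e. (norm (A e))\<^sup>2) G"
        using E G closure_subset[of "cspan G"]
        by (intro sum_norm_sq_le_hilbert_schmidt[of "closure (cspan G)" G A E] A)
           (auto simp: orthonormal_basis_iff)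
      also have "\<dots> = (\<Sum>e\<in>G. (norm (A e))\<^sup>2)" using G(1) by simp
      finally show "(\<Sum>e\<in>E. (norm (A e))\<^sup>2) \<le> (\<Sum>x\<in>insert x X. (norm (A x))\<^sup>2)"
        using X(1,5) nX G' by simp
    qed (use X(1) in auto)
  qed
qed

section \<open>Idempotents with Hilbert-Schmidt nilpotent part\<close>

lemma orthonormal_empty: "orthonormal {}"
  by (simp add: orthonormal_def)

lemma corthogonal_Int_eq_0: "x \<in> M \<Longrightarrow> x \<in> corthogonal M \<Longrightarrow> x = 0"
  using cinner_self[of x] by (auto simp: corthogonal_def)

text \<open>Existence is pointwise: P x is x minus its nearest point in M. Uniqueness of the
  splitting then yields linearity and idempotence, because the expected value always splits
  correctly.\<close>

lemma complement_projection_exists: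
  fixes M :: "'a::complex_hilbert set"
  assumes M: "closed M" "complex_vector.subspace M"
  obtains P where "is_projection P" "\<And>x. P x \<in> corthogonal M" "\<And>x. x - P x \<in> M"
proof -
  have "\<exists>p. p \<in> corthogonal M \<and> x - p \<in> M" for x
  proof -
    obtain q where "q \<in> closure M" "\<And>s. s \<in> M \<Longrightarrow> cinner (x - q) s = 0"
      using orthogonal_projection_closure[OF M(2)] by metis
    then show ?thesis using M(1) by (intro exI[of _ "x - q"]) (auto simp: corthogonal_def)
  qed
  then obtain P where P: "\<And>x. P x \<in> corthogonal M" "\<And>x. x - P x \<in> M" by metis
  note sub = complex_vector.subspace_add complex_vector.subspace_diff complex_vector.subspace_scale
  have uniq: "P x = p" if "p \<in> corthogonal M" "x - p \<in> M" for x p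
  proof -
    have "(x - p) - (x - P x) \<in> M" by (rule sub(2)[OF M(2) that(2) P(2)])
    moreover have "P x - p \<in> corthogonal M" by (rule sub(2)[OF subspace_corthogonal P(1) that(1)])
    ultimately show ?thesis using corthogonal_Int_eq_0[of "P x - p"] by simp
  qed
  have add: "P (x + y) = P x + P y" for x y
  proof (rule uniq)
    have eq: "x + y - (P x + P y) = (x - P x) + (y - P y)" by simp
    show "x + y - (P x + P y) \<in> M" unfolding eq by (rule sub(1)[OF M(2) P(2) P(2)])
    show "P x + P y \<in> corthogonal M" by (rule sub(1)[OF subspace_corthogonal P(1) P(1)])
  qed
  have sc: "P (scaleC c x) = scaleC c (P x)" for c x
  proof (rule uniq)
    show "scaleC c x - scaleC c (P x) \<in> M"
      unfolding scaleC.diff_right[symmetric] by (rule sub(3)[OF M(2) P(2)])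
    show "scaleC c (P x) \<in> corthogonal M" by (rule sub(3)[OF subspace_corthogonal P(1)])
  qed
  have orth: "cinner (P x) (y - P y) = 0" for x y
    using P by (auto simp: corthogonal_def)
  have "(norm (P x))\<^sup>2 \<le> (norm x)\<^sup>2" for x
    using norm_sq_add[of "P x" "x - P x"] orth[of x x] by simp
  then have "norm (P x) \<le> norm x" for x by (rule power2_le_imp_le) simp
  then have "bounded_linear P"
    using add sc[of "of_real r" for r]
    by (intro bounded_linear_intro[of _ 1]) (simp_all add: scaleC_of_real)
  moreover have "P (P x) = P x" for x
    using complex_vector.subspace_0[OF M(2)] by (intro uniq P) simp
  moreover have "cinner (P x) y = cinner x (P y)" for x y
  proof -
    have "cinner (P x) (y - P y) = 0" "cinner (x - P x) (P y) = 0"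
      using orth[of x y] orth[of y x] cinner_eq_0_commute by blast+
    then show ?thesis by (simp add: cinner.diff_left cinner.diff_right)
  qed
  ultimately have "is_projection P"
    using sc by (auto simp: is_projection_def bounded_clinear_def is_cadjoint_def)
  then show thesis using P by (rule that)
qed

lemma idempotent_bounded_clinear: "is_idempotent D \<Longrightarrow> bounded_clinear D"
  by (simp add: is_idempotent_def)

lemma idempotent_diff_in_ker:
  assumes "is_idempotent D"
  shows "D x - x \<in> ker D"
proof -
  interpret bounded_linear D using assms by (simp add: is_idempotent_def bounded_clinear_def)
  show ?thesis using assms by (simp add: ker_def diff is_idempotent_def fun_eq_iff)
qed

lemma bounded_clinear_diff:
  assumes "bounded_clinear S" "bounded_clinear T"
  shows "bounded_clinear (\<lambda>x. S x - T x)"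
  using assms by (auto simp: bounded_clinear_def bounded_linear_sub scaleC.diff_right)

lemma bounded_clinear_id: "bounded_clinear (\<lambda>x. x)"
  by (simp add: bounded_clinear_def)

text \<open>On the complement of the kernel \<open>D e - e\<close> is the nilpotent part, so the
  definite description in \<open>orthogonal_proj\<close> need not be unfolded again.\<close>

lemma hilbert_schmidt_on_nilpotent_part_iff:
  assumes D: "is_idempotent D"
  shows "hilbert_schmidt_on (corthogonal (ker D)) (nilpotent_part D) \<longleftrightarrow>
    (\<exists>E. orthonormal_basis (corthogonal (ker D)) E \<and> (\<lambda>e. (norm (D e - e))\<^sup>2) summable_on E)"
proof -
  have "nilpotent_part D e = D e - e" if "orthonormal_basis (corthogonal (ker D)) E" "e \<in> E" for E e
    using nilpotent_part_block_form(2)[OF D orthonormal_basis_mem[OF that]] by simp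
  then have "(\<lambda>e. (norm (nilpotent_part D e))\<^sup>2) summable_on E
      \<longleftrightarrow> (\<lambda>e. (norm (D e - e))\<^sup>2) summable_on E"
    if "orthonormal_basis (corthogonal (ker D)) E" for E
    using that by (intro summable_on_cong) simp
  then show ?thesis unfolding hilbert_schmidt_on_def by blast
qed

lemma orthonormal_basis_exists:
  fixes M :: "'a::complex_hilbert set"
  assumes "closed M" "complex_vector.subspace M"
  obtains E where "orthonormal_basis M E"
  by (rule orthonormal_basis_extend[OF assms, of "{}"]) (auto simp: orthonormal_def)

lemma orthonormal_basis_Un:
  fixes M :: "'a::complex_hilbert set"
  assumes M: "closed M" "complex_vector.subspace M"
    and E: "orthonormal_basis (corthogonal M) E" and F: "orthonormal_basis M F"
  shows "orthonormal_basis UNIV (E \<union> F)" "E \<inter> F = {}"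
proof -
  have oE: "orthonormal E" and oF: "orthonormal F" using E F by (simp_all add: orthonormal_basis_iff)
  have EF: "cinner e f = 0" "cinner f e = 0" if "e \<in> E" "f \<in> F" for e f
    using orthonormal_basis_mem[OF E that(1)] orthonormal_basis_mem[OF F that(2)]
      cinner_eq_0_commute[of e f] by (auto simp: corthogonal_def)
  show disj: "E \<inter> F = {}"
    using EF(1) orthonormal_cinner[OF oE] by fastforce
  show "orthonormal_basis UNIV (E \<union> F)"
  proof (rule orthonormal_basisI)
    show "orthonormal (E \<union> F)"
      unfolding orthonormal_def using EF disj orthonormal_cinner[OF oE] orthonormal_cinner[OF oF]
      by auto
    fix z assume z: "\<And>e. e \<in> E \<union> F \<Longrightarrow> cinner z e = 0"
    obtain P where P: "is_projection P" "\<And>x. P x \<in> corthogonal M" "\<And>x. x - P x \<in> M"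
      using complement_projection_exists[OF M] by metis
    have "P z = 0"
    proof (rule orthonormal_basis_orthogonal_eq_0[OF E P(2)])
      fix e assume "e \<in> E"
      then have "cinner e (z - P z) = 0"
        using orthonormal_basis_mem[OF E] P(3) by (auto simp: corthogonal_def)
      then have "cinner (z - P z) e = 0" by (simp add: cinner_eq_0_commute[of e])
      then show "cinner (P z) e = 0" using z \<open>e \<in> E\<close> by (simp add: cinner.diff_left)
    qed
    then show "z = 0" using orthonormal_basis_orthogonal_eq_0[OF F, of z] P(3)[of z] z by simp
  qed auto
qed

text \<open>P is the orthogonal projection onto the complement of the kernel. Then D - P is the
  nilpotent part extended by zero, and over a basis adapted to the splitting its Hilbert-Schmidt sum
  is that of the nilpotent part.\<close>

lemma hilbert_schmidt_perturbation_if_nilpotent_part: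
  fixes D :: "'a::complex_hilbert \<Rightarrow> 'a"
  assumes D: "is_idempotent D"
    and HS: "hilbert_schmidt_on (corthogonal (ker D)) (nilpotent_part D)"
  shows "\<exists>P K. is_projection P \<and> hilbert_schmidt K \<and> D = (\<lambda>x. P x + K x)"
proof -
  note ker = bounded_clinear_ker[OF idempotent_bounded_clinear[OF D]]
  obtain P where P: "is_projection P" "\<And>x. P x \<in> corthogonal (ker D)" "\<And>x. x - P x \<in> ker D"
    using complement_projection_exists[OF ker] by metis
  obtain E where E: "orthonormal_basis (corthogonal (ker D)) E"
    "(\<lambda>e. (norm (D e - e))\<^sup>2) summable_on E"
    using HS unfolding hilbert_schmidt_on_nilpotent_part_iff[OF D] by blast
  obtain F where F: "orthonormal_basis (ker D) F" using orthonormal_basis_exists[OF ker] .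
  note EF = orthonormal_basis_Un[OF ker E(1) F]
  define K where "K x = D x - P x" for x
  have K: "bounded_clinear K"
    unfolding K_def using D P(1)
    by (intro bounded_clinear_diff) (auto simp: is_idempotent_def is_projection_def)
  have KE: "K e = D e - e" if "e \<in> E" for e
  proof -
    have "e - P e \<in> corthogonal (ker D)"
      using orthonormal_basis_mem[OF E(1) that] P(2)
      by (intro complex_vector.subspace_diff subspace_corthogonal)
    with P(3) have "e - P e = 0" by (rule corthogonal_Int_eq_0)
    then show ?thesis by (simp add: K_def)
  qed
  have KF: "K f = 0" if "f \<in> F" for f
  proof -
    have f: "f \<in> ker D" using orthonormal_basis_mem[OF F that] .
    have "f - (f - P f) \<in> ker D" by (rule complex_vector.subspace_diff[OF ker(2) f P(3)])
    then have "P f = 0" using P(2) by (intro corthogonal_Int_eq_0[of "P f"]) auto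
    then show ?thesis using f by (simp add: K_def ker_def)
  qed
  have "(\<lambda>e. (norm (K e))\<^sup>2) summable_on (E \<union> F) \<longleftrightarrow> (\<lambda>e. (norm (D e - e))\<^sup>2) summable_on E"
    using KE KF by (intro summable_on_cong_neutral) auto
  then have "hilbert_schmidt K"
    using K EF(1) E(2) by (auto simp: hilbert_schmidt_def hilbert_schmidt_on_def)
  moreover have "D = (\<lambda>x. P x + K x)" by (simp add: K_def)
  ultimately show ?thesis using P(1) by blast
qed

text \<open>
  For \<open>e\<close> orthogonal to \<open>ker D\<close> and \<open>h\<close> in \<open>ker D\<close>, self-adjointness of the projection cancels its
  contribution: \<open>(De, h) = (Ke, h) - (e, Kh)\<close>. So only sums of \<open>K\<close> over orthonormal sets occur.
\<close>

lemma nilpotent_part_if_hilbert_schmidt_perturbation: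
  fixes D :: "'a::complex_hilbert \<Rightarrow> 'a"
  assumes D: "is_idempotent D" and P: "is_projection P" and K: "hilbert_schmidt K"
    and DPK: "D = (\<lambda>x. P x + K x)"
  shows "hilbert_schmidt_on (corthogonal (ker D)) (nilpotent_part D)"
proof -
  have Kb: "bounded_clinear K" using K by (simp add: hilbert_schmidt_def)
  obtain F where F: "orthonormal_basis UNIV F" "(\<lambda>f. (norm (K f))\<^sup>2) summable_on F"
    using K unfolding hilbert_schmidt_def hilbert_schmidt_on_def by blast
  define C where "C = infsum (\<lambda>f. (norm (K f))\<^sup>2) F"
  have C: "(\<Sum>e\<in>G. (norm (K e))\<^sup>2) \<le> C" if "finite G" "orthonormal G" for G
    unfolding C_def by (rule sum_norm_sq_le_hilbert_schmidt[OF F(1) Kb F(2) that]) simp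
  obtain E where E: "orthonormal_basis (corthogonal (ker D)) E"
    using orthonormal_basis_exists[OF closed_corthogonal subspace_corthogonal] by blast
  \<comment> \<open>Two sums of K occur, each at most C, and |a - b|^2 <= 2 |a|^2 + 2 |b|^2 doubles
    both; hence 4 C.\<close>
  have "(\<Sum>e\<in>E'. (norm (D e - e))\<^sup>2) \<le> 4 * C" if E': "finite E'" "E' \<subseteq> E" for E'
  proof -
    have oE': "orthonormal E'" using E E'(2) orthonormal_subset by (auto simp: orthonormal_basis_iff)
    have sub: "complex_vector.subspace (ker D)"
      by (rule bounded_clinear_ker[OF idempotent_bounded_clinear[OF D]])
    have img: "(\<lambda>e. D e - e) ` E' \<subseteq> ker D" using idempotent_diff_in_ker[OF D] by blast
    obtain H where H: "finite H" "orthonormal H" "H \<subseteq> ker D" "(\<lambda>e. D e - e) ` E' \<subseteq> cspan H"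
      by (rule gram_schmidt[OF sub finite_imageI[OF E'(1)] img finite.emptyI orthonormal_empty
            empty_subsetI])
    have key: "cinner (D e - e) h = cinner (K e) h - cinner e (K h)" if "e \<in> E'" "h \<in> H" for e h
    proof -
      have "cinner e h = 0"
        using orthonormal_basis_mem[OF E, of e] E' H(3) that by (auto simp: corthogonal_def)
      moreover have "D h = 0" using H(3) that by (auto simp: ker_def)
      then have "P h = - K h" using fun_cong[OF DPK, of h] by (simp add: eq_neg_iff_add_eq_0)
      then have "cinner e (P h) = - cinner e (K h)" by (simp add: cinner.minus_right)
      moreover have "cinner (P e) h = cinner e (P h)"
        using P by (simp add: is_projection_def is_cadjoint_def)
      moreover have "D e = P e + K e" by (rule fun_cong[OF DPK])
      ultimately show ?thesis by (simp add: cinner.diff_left cinner.add_left)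
    qed
    have sq: "(cmod (a - b))\<^sup>2 \<le> 2 * (cmod a)\<^sup>2 + 2 * (cmod b)\<^sup>2" for a b
    proof -
      have "(cmod (a - b))\<^sup>2 \<le> (cmod a + cmod b)\<^sup>2"
        by (intro power_mono norm_triangle_ineq4) simp
      also have "\<dots> \<le> 2 * (cmod a)\<^sup>2 + 2 * (cmod b)\<^sup>2"
        using zero_le_power2[of "cmod a - cmod b"] by (simp add: power2_eq_square algebra_simps)
      finally show ?thesis .
    qed
    have "(\<Sum>e\<in>E'. (norm (D e - e))\<^sup>2) = (\<Sum>e\<in>E'. \<Sum>h\<in>H. (cmod (cinner (D e - e) h))\<^sup>2)"
      using H by (intro sum.cong refl parseval_finite[symmetric]) auto
    also have "\<dots> \<le> (\<Sum>e\<in>E'. \<Sum>h\<in>H. 2 * (cmod (cinner (K e) h))\<^sup>2 + 2 * (cmod (cinner (K h) e))\<^sup>2)"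
    proof (intro sum_mono)
      fix e h assume "e \<in> E'" "h \<in> H"
      from key[OF this] show "(cmod (cinner (D e - e) h))\<^sup>2
        \<le> 2 * (cmod (cinner (K e) h))\<^sup>2 + 2 * (cmod (cinner (K h) e))\<^sup>2"
        unfolding cmod_cinner_commute[of "K h"] using sq by simp
    qed
    also have "\<dots> = 2 * (\<Sum>e\<in>E'. \<Sum>h\<in>H. (cmod (cinner (K e) h))\<^sup>2)
        + 2 * (\<Sum>h\<in>H. \<Sum>e\<in>E'. (cmod (cinner (K h) e))\<^sup>2)"
      unfolding sum.swap[of _ H E'] by (simp add: sum.distrib sum_distrib_left)
    also have "\<dots> \<le> 2 * (\<Sum>e\<in>E'. (norm (K e))\<^sup>2) + 2 * (\<Sum>h\<in>H. (norm (K h))\<^sup>2)"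
      by (intro add_mono mult_left_mono sum_mono bessel_le H E' oE') auto
    also have "\<dots> \<le> 4 * C" using C[OF E'(1) oE'] C[OF H(1,2)] by simp
    finally show ?thesis .
  qed
  then have "(\<lambda>e. (norm (D e - e))\<^sup>2) summable_on E"
    by (intro nonneg_bdd_above_summable_on bdd_aboveI[of _ "4 * C"]) auto
  then show ?thesis using E unfolding hilbert_schmidt_on_nilpotent_part_iff[OF D] by blast
qed

section \<open>Divergence of diagonal sums\<close>

text \<open>\<open>D z\<close> depends only on the component of z in the complement of the kernel,
  so a finite basis there would make the range finite-dimensional. This is where infinite rank
  enters.\<close>

lemma orthonormal_basis_corthogonal_ker_infinite:
  fixes D :: "'a::complex_hilbert \<Rightarrow> 'a"
  assumes D: "bounded_clinear D" and inf: "infinite_cdim (range D)"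
    and E: "orthonormal_basis (corthogonal (ker D)) E"
  shows "infinite E"
proof
  assume fin: "finite E"
  interpret bounded_linear D using D by (simp add: bounded_clinear_def)
  have DC: "D (scaleC a y) = scaleC a (D y)" for a y using D by (simp add: bounded_clinear_def)
  have oE: "orthonormal E" using E by (simp add: orthonormal_basis_iff)
  obtain P where P: "is_projection P" "\<And>x. P x \<in> corthogonal (ker D)" "\<And>x. x - P x \<in> ker D"
    using complement_projection_exists[OF bounded_clinear_ker[OF D]] by metis
  have "D z \<in> cspan (D ` E)" for z
  proof -
    define p where "p = (\<Sum>e\<in>E. scaleC (cinner (P z) e) e)"
    have "p \<in> corthogonal (ker D)" unfolding p_def
      using orthonormal_basis_mem[OF E]
      by (intro complex_vector.subspace_sum complex_vector.subspace_scale subspace_corthogonal)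
    then have "P z - p \<in> corthogonal (ker D)"
      using P(2) by (intro complex_vector.subspace_diff subspace_corthogonal)
    moreover have "cinner (P z - p) e = 0" if "e \<in> E" for e
      unfolding p_def cinner.diff_left using that by (simp add: cinner_sum_orthonormal fin oE)
    ultimately have "P z - p = 0" by (rule orthonormal_basis_orthogonal_eq_0[OF E])
    moreover have "D (z - P z) = 0" using P(3) by (simp add: ker_def)
    ultimately have "D z = D p" by (simp add: diff)
    also have "\<dots> = (\<Sum>e\<in>E. scaleC (cinner (P z) e) (D e))" by (simp add: p_def sum DC)
    also have "\<dots> \<in> cspan (D ` E)"
      by (intro complex_vector.span_sum complex_vector.span_scale complex_vector.span_base imageI)
    finally show ?thesis .
  qed
  then show False using inf fin unfolding infinite_cdim_def by blast
qed

text \<open>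
  Writing \<open>g = x + y\<close> along \<open>(ker D)\<^sup>\<bottom> \<oplus> ker D\<close> one has \<open>(Dg, g) = |x|\<^sup>2 + (Tx, y)\<close>, and by
  AM-GM the cross term costs at most \<open>|x|\<^sup>2/2\<close> plus a quantity summing to the Hilbert-Schmidt norm.
\<close>

lemma sum_diagonal_lower_bound:
  fixes D :: "'a::complex_hilbert \<Rightarrow> 'a"
  assumes D: "is_idempotent D" and E: "orthonormal_basis (corthogonal (ker D)) E"
    and sm: "(\<lambda>e. (norm (D e - e))\<^sup>2) summable_on E"
    and P: "is_projection P" "\<And>x. P x \<in> corthogonal (ker D)" "\<And>x. x - P x \<in> ker D"
    and G: "finite G" "orthonormal G"
  shows "((\<Sum>g\<in>G. (norm (P g))\<^sup>2) - infsum (\<lambda>e. (norm (D e - e))\<^sup>2) E) / 2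
    \<le> (\<Sum>g\<in>G. Re (cinner (D g) g))"
proof -
  interpret D: bounded_linear D using D by (simp add: is_idempotent_def bounded_clinear_def)
  have T: "bounded_clinear (\<lambda>x. D x - x)"
    by (intro bounded_clinear_diff bounded_clinear_id idempotent_bounded_clinear D)
  define S where "S g = infsum (\<lambda>e. (cmod (cinner (D e - e) g))\<^sup>2) E" for g
  have le: "((norm (P g))\<^sup>2 - S g) / 2 \<le> Re (cinner (D g) g)" for g
  proof -
    define c where "c = cinner (D (P g) - P g) g"
    have "cinner (P g) (g - P g) = 0" using P(2)[of g] P(3)[of g] by (simp add: corthogonal_def)
    then have x: "cinner (P g) g = of_real ((norm (P g))\<^sup>2)"
      by (simp add: cinner.diff_right cinner_self)
    have "D (g - P g) = 0" using P(3)[of g] by (simp add: ker_def)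
    then have "D g = P g + (D (P g) - P g)" by (simp add: D.diff)
    then have eq: "Re (cinner (D g) g) = (norm (P g))\<^sup>2 + Re c"
      by (metis c_def x cinner.add_left plus_complex.sel(1) Re_complex_of_real)
    have S0: "0 \<le> S g" unfolding S_def by (rule infsum_nonneg) simp
    have "(cmod c)\<^sup>2 \<le> S g * (norm (P g))\<^sup>2"
      unfolding c_def S_def by (rule functional_bound_infsum[OF E T sm P(2)])
    also have "\<dots> \<le> ((S g + (norm (P g))\<^sup>2) / 2)\<^sup>2"
      using zero_le_power2[of "S g - (norm (P g))\<^sup>2"] by (simp add: power2_eq_square field_simps)
    finally have "cmod c \<le> (S g + (norm (P g))\<^sup>2) / 2"
      using S0 by (intro power2_le_imp_le[of "cmod c"]) simp_all
    moreover have "- cmod c \<le> Re c" using abs_Re_le_cmod[of c] by linarith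
    ultimately show ?thesis unfolding eq by (simp add: field_simps)
  qed
  have "(\<Sum>g\<in>G. S g) \<le> infsum (\<lambda>e. (norm (D e - e))\<^sup>2) E"
    unfolding S_def by (rule infsum_bessel[OF sm G])
  then have "((\<Sum>g\<in>G. (norm (P g))\<^sup>2) - infsum (\<lambda>e. (norm (D e - e))\<^sup>2) E) / 2
      \<le> (\<Sum>g\<in>G. ((norm (P g))\<^sup>2 - S g) / 2)"
    by (simp add: sum_subtractf flip: sum_divide_distrib)
  also have "\<dots> \<le> (\<Sum>g\<in>G. Re (cinner (D g) g))" by (intro sum_mono le)
  finally show ?thesis .
qed

text \<open>The complement of the kernel contains N orthonormal vectors for every N. A long initial
  segment of the basis captures half of each, so its projections have total square norm at least N /
  2, and the lower bound on the diagonal outgrows any bound on the partial sums.\<close>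

lemma not_summable_diagonal_if_nilpotent_part:
  fixes D :: "'a::complex_hilbert \<Rightarrow> 'a"
  assumes D: "is_idempotent D" and inf: "infinite_cdim (range D)"
    and HS: "hilbert_schmidt_on (corthogonal (ker D)) (nilpotent_part D)"
  shows "\<not> summable_diagonal D"
proof
  assume "summable_diagonal D"
  then obtain e s where e: "orthonormal_basis_seq e" and s: "(\<lambda>j. cinner (D (e j)) (e j)) sums s"
    unfolding summable_diagonal_def trace_set_def by blast
  have inj: "inj e" and be: "orthonormal_basis UNIV (range e)"
    using e by (simp_all add: orthonormal_basis_seq_def)
  have oe: "orthonormal (range e)" using be by (simp add: orthonormal_basis_iff)
  obtain E where E: "orthonormal_basis (corthogonal (ker D)) E"
    "(\<lambda>e. (norm (D e - e))\<^sup>2) summable_on E"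
    using HS unfolding hilbert_schmidt_on_nilpotent_part_iff[OF D] by blast
  have oE: "orthonormal E" using E by (simp add: orthonormal_basis_iff)
  obtain P where P: "is_projection P" "\<And>x. P x \<in> corthogonal (ker D)" "\<And>x. x - P x \<in> ker D"
    using complement_projection_exists[OF bounded_clinear_ker[OF idempotent_bounded_clinear[OF D]]]
    by metis
  define C where "C = infsum (\<lambda>e. (norm (D e - e))\<^sup>2) E"
  have "(\<lambda>n. \<Sum>j<n. cinner (D (e j)) (e j)) \<longlonglongrightarrow> s" using s by (simp add: sums_def)
  then have "Bseq (\<lambda>n. \<Sum>j<n. cinner (D (e j)) (e j))" using convergentI convergent_imp_Bseq by blast
  then obtain B where B: "\<And>n. cmod (\<Sum>j<n. cinner (D (e j)) (e j)) \<le> B"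
    unfolding Bseq_def by blast
  \<comment> \<open>The threshold is (N / 2 - C) / 2 > B solved for N.\<close>
  obtain N :: nat where N: "4 * B + 2 * C < real N" using reals_Archimedean2 by blast
  have "infinite E"
    by (rule orthonormal_basis_corthogonal_ker_infinite[OF idempotent_bounded_clinear[OF D] inf E(1)])
  then obtain U where U: "finite U" "card U = N" "U \<subseteq> E" using infinite_arbitrarily_large by metis
  have oU: "orthonormal U" using oE U(3) by (rule orthonormal_subset)
  have "\<exists>F. finite F \<and> F \<subseteq> range e \<and> 1 / 2 < (\<Sum>f\<in>F. (cmod (cinner u f))\<^sup>2)" if "u \<in> U" for u
    by (rule parseval_approx[OF be, of u "1/2"]) (use orthonormal_norm[OF oU that] in auto)
  then obtain F where F: "\<And>u. u \<in> U \<Longrightarrow> finite (F u)" "\<And>u. u \<in> U \<Longrightarrow> F u \<subseteq> range e"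
    "\<And>u. u \<in> U \<Longrightarrow> 1 / 2 < (\<Sum>f\<in>F u. (cmod (cinner u f))\<^sup>2)" by metis
  have "finite (\<Union>u\<in>U. F u)" "(\<Union>u\<in>U. F u) \<subseteq> range e" using U(1) F by auto
  then obtain J where J: "finite J" "(\<Union>u\<in>U. F u) = e ` J" by (metis finite_subset_image)
  \<comment> \<open>Convergence controls only the ordered partial sums, so the captured vectors are
    enclosed in an initial segment; enlarging the set cannot lower the captured mass.\<close>
  obtain n where n: "J \<subseteq> {..<n}" using J(1) finite_nat_iff_bounded by blast
  define G where "G = e ` {..<n}"
  have G: "finite G" "orthonormal G"
    using orthonormal_subset[OF oe, of G] by (auto simp: G_def)
  have FG: "F u \<subseteq> G" if "u \<in> U" for u using that J(2) n by (auto simp: G_def)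
  have "real N / 2 = (\<Sum>u\<in>U. 1 / 2)" using U(2) by simp
  also have "\<dots> \<le> (\<Sum>u\<in>U. \<Sum>g\<in>G. (cmod (cinner u g))\<^sup>2)"
  proof (rule sum_mono)
    fix u assume u: "u \<in> U"
    have "(\<Sum>f\<in>F u. (cmod (cinner u f))\<^sup>2) \<le> (\<Sum>g\<in>G. (cmod (cinner u g))\<^sup>2)"
      using FG[OF u] G(1) by (intro sum_mono2) auto
    with F(3)[OF u] show "1 / 2 \<le> (\<Sum>g\<in>G. (cmod (cinner u g))\<^sup>2)" by linarith
  qed
  also have "\<dots> = (\<Sum>g\<in>G. \<Sum>u\<in>U. (cmod (cinner u g))\<^sup>2)" by (rule sum.swap)
  also have "\<dots> = (\<Sum>g\<in>G. \<Sum>u\<in>U. (cmod (cinner (P g) u))\<^sup>2)"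
  proof (intro sum.cong refl)
    fix g u assume "u \<in> U"
    then have "cinner u (g - P g) = 0"
      using orthonormal_basis_mem[OF E(1)] U(3) P(3) by (auto simp: corthogonal_def)
    then have "cinner u g = cinner u (P g)" by (simp add: cinner.diff_right)
    then show "(cmod (cinner u g))\<^sup>2 = (cmod (cinner (P g) u))\<^sup>2"
      by (simp add: cmod_cinner_commute[of u])
  qed
  also have "\<dots> \<le> (\<Sum>g\<in>G. (norm (P g))\<^sup>2)" by (intro sum_mono bessel_le U oU)
  finally have "(real N / 2 - C) / 2 \<le> (\<Sum>g\<in>G. Re (cinner (D g) g))"
    using sum_diagonal_lower_bound[OF D E P G] by (simp add: C_def)
  also have "\<dots> = Re (\<Sum>j<n. cinner (D (e j)) (e j))"
    unfolding G_def using inj by (subst sum.reindex) (auto intro: inj_on_subset)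
  also have "\<dots> \<le> B" using B[of n] complex_Re_le_cmod order_trans by blast
  finally show False using N by simp
qed

section \<open>Separability and enumeration of bases\<close>

text \<open>Distinct orthonormal vectors are at distance sqrt 2, so points of a countable dense set
  chosen within 1/2 of them are distinct.\<close>

lemma orthonormal_countable:
  fixes E :: "'a::complex_inner set"
  assumes sep: "separable_space (euclidean :: 'a topology)" and E: "orthonormal E"
  shows "countable E"
proof -
  obtain C :: "'a set" where C: "countable C" "closure C = UNIV"
    using sep by (auto simp: separable_space_def)
  have "\<exists>c\<in>C. dist c e < 1 / 2" for e
    using C(2) closure_approachable[of e C] by (metis UNIV_I half_gt_zero_iff zero_less_one)
  then obtain c where c: "\<And>e. c e \<in> C" "\<And>e. dist (c e) e < 1 / 2" by metis
  have "inj_on c E"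
  proof (rule inj_onI, rule ccontr)
    fix x y assume xy: "x \<in> E" "y \<in> E" "c x = c y" "x \<noteq> y"
    have "dist x y < 1" using c(2)[of x] c(2)[of y] xy(3) dist_triangle_half_r by metis
    then have "(norm (x + - y))\<^sup>2 < 1" by (simp add: dist_norm power_less_one_iff abs_square_less_1)
    moreover have "(norm (x + - y))\<^sup>2 = 2"
      unfolding norm_sq_add using xy E orthonormal_norm[OF E] orthonormal_cinner[OF E]
      by (simp add: cinner.minus_right)
    ultimately show False by simp
  qed
  moreover have "c ` E \<subseteq> C" using c(1) by blast
  ultimately show ?thesis using C(1) countable_image_inj_on countable_subset by blast
qed

text \<open>A bridge between two notions of basis: \<open>zero_diagonal\<close> speaks of sets,
  traces of sequences. A finite basis would span the space algebraically, so E is countably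
  infinite.\<close>

lemma orthonormal_basis_enumerate:
  fixes E :: "'a::complex_inner set"
  assumes sep: "separable_space (euclidean :: 'a topology)" and inf: "infinite_cdim (UNIV :: 'a set)"
    and E: "orthonormal_basis UNIV E"
  obtains e where "orthonormal_basis_seq e" "range e = E"
proof -
  have oE: "orthonormal E" using E by (simp add: orthonormal_basis_iff)
  have "infinite E"
  proof
    assume fin: "finite E"
    have "x \<in> cspan E" for x
    proof -
      define p where "p = (\<Sum>e\<in>E. scaleC (cinner x e) e)"
      have "cinner (x - p) e = 0" if "e \<in> E" for e
        unfolding p_def cinner.diff_left using that by (simp add: cinner_sum_orthonormal fin oE)
      then have "x - p = 0" by (intro orthonormal_basis_orthogonal_eq_0[OF E]) auto
      moreover have "p \<in> cspan E" unfolding p_def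
        by (intro complex_vector.span_sum complex_vector.span_scale complex_vector.span_base)
      ultimately show ?thesis by simp
    qed
    then show False using inf fin unfolding infinite_cdim_def by blast
  qed
  then have "bij_betw (from_nat_into E) UNIV E"
    by (intro bij_betw_from_nat_into orthonormal_countable[OF sep oE])
  then have "inj (from_nat_into E)" "range (from_nat_into E) = E" by (auto simp: bij_betw_def)
  with E that show thesis by (metis orthonormal_basis_seq_def)
qed

section \<open>Prescribing diagonals on finite-dimensional subspaces\<close>

text \<open>As \<omega> runs over the unit circle, the left side runs over the circle with centre
  \<beta>^2 and radius \<beta> sqrt(1 - \<beta>^2) c. A zero of \<open>f\<close>, the radius minus
  the distance of z from the centre, is a circle through z.\<close>

lemma disc_parameters:
  fixes c N :: real and z :: complex
  assumes c: "0 < c" "c \<le> N" and N: "1 \<le> N" and z: "cmod z \<le> c\<^sup>2 / (16 * N)"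
  obtains \<beta> \<omega> where "0 \<le> \<beta>" "\<beta> \<le> 1" "cmod \<omega> = 1"
    "of_real (\<beta>\<^sup>2) + of_real (\<beta> * sqrt (1 - \<beta>\<^sup>2) * c) * \<omega> = z"
proof -
  define f where "f \<beta> = \<beta> * sqrt (1 - \<beta>\<^sup>2) * c - cmod (z - of_real (\<beta>\<^sup>2))" for \<beta>
  \<comment> \<open>Here the radius is at least b c / 2 = c^2 / (8 N), while the centre b^2 costs at
    most c^2 / (16 N); the difference is the room granted to z.\<close>
  define b where "b = c / (4 * N)"
  have b: "0 \<le> b" "b \<le> 1 / 4" using c N by (simp_all add: b_def field_simps)
  have "b\<^sup>2 \<le> (1 / 4)\<^sup>2" using b by (intro power_mono) auto
  then have "(1 / 2)\<^sup>2 \<le> 1 - b\<^sup>2" by (simp add: power2_eq_square)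
  then have sq: "1 / 2 \<le> sqrt (1 - b\<^sup>2)" by (rule real_le_rsqrt)
  have "b * (1 / 2) * c \<le> b * sqrt (1 - b\<^sup>2) * c"
    using b c sq by (intro mult_right_mono mult_left_mono) auto
  moreover have "b * (1 / 2) * c = 2 * (c\<^sup>2 / (16 * N))"
    by (simp add: b_def power2_eq_square)
  moreover have "b\<^sup>2 \<le> c\<^sup>2 / (16 * N)"
  proof -
    have "c\<^sup>2 * N \<le> c\<^sup>2 * N\<^sup>2"
      using N by (intro mult_left_mono) (simp_all add: power2_eq_square)
    then show ?thesis
      using N by (simp add: b_def power_divide power_mult_distrib field_simps power2_eq_square)
  qed
  moreover have "cmod (z - of_real (b\<^sup>2)) \<le> cmod z + b\<^sup>2"
    using norm_triangle_ineq4[of z "of_real (b\<^sup>2)"] by (simp only: norm_of_real abs_power2)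
  ultimately have "0 \<le> f b" using z unfolding f_def by linarith
  moreover have "f 0 \<le> 0" by (simp add: f_def)
  moreover have "continuous_on {0..b} f"
    unfolding f_def by (intro continuous_intros)
  ultimately obtain \<beta> where \<beta>: "0 \<le> \<beta>" "\<beta> \<le> b" "f \<beta> = 0"
    using IVT'[of f 0 0 b] b(1) by blast
  define r where "r = \<beta> * sqrt (1 - \<beta>\<^sup>2) * c"
  have r: "cmod (z - of_real (\<beta>\<^sup>2)) = r" using \<beta>(3) by (simp add: f_def r_def)
  \<comment> \<open>For r = 0 the point z is the centre itself and any phase works.\<close>
  define \<omega> where "\<omega> = (if r = 0 then 1 else (z - of_real (\<beta>\<^sup>2)) / of_real r)"
  have "cmod \<omega> = 1" using r by (auto simp: \<omega>_def norm_divide)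
  moreover have "of_real (\<beta>\<^sup>2) + of_real r * \<omega> = z" using r by (auto simp: \<omega>_def)
  ultimately show thesis using that[of \<beta> \<omega>] \<beta> b by (auto simp: r_def)
qed

lemma bounded_clinear_combination:
  "bounded_clinear D \<Longrightarrow> D (scaleC a x + scaleC b y) = scaleC a (D x) + scaleC b (D y)"
  using linear_add[of D] by (simp add: bounded_clinear_def bounded_linear.linear)

lemma cspan_pair_combination: "scaleC a x + scaleC b y \<in> cspan {x, y}"
  by (intro complex_vector.span_add complex_vector.span_scale complex_vector.span_base) auto

text \<open>Relative to \<alpha> the diagonal entries are a >= 0 and -t <= 0. Once a phase makes the
  cross terms a real multiple of \<alpha>, rotating u into w moves the entry along the real line
  from a to -t, so it vanishes at some angle; the other vector then carries the whole trace.\<close>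

lemma rotate_pair:
  assumes D: "bounded_clinear D" and uw: "orthonormal {u, w}" "u \<noteq> w"
    and a: "0 \<le> a" "cinner (D u) u = of_real a * \<alpha>"
    and t: "0 \<le> t" "cinner (D w) w = - (of_real t * \<alpha>)"
  obtains g v where "orthonormal {g, v}" "g \<noteq> v" "{g, v} \<subseteq> cspan {u, w}" "{u, w} \<subseteq> cspan {g, v}"
    "cinner (D g) g = 0" "cinner (D v) v = of_real (a - t) * \<alpha>"
proof (cases "\<alpha> = 0")
  case True
  then show thesis using that[of u w] uw a t by (simp add: complex_vector.span_base)
next
  case False
  define p q where "p = cinner (D w) u" and "q = cinner (D u) w"
  define d where "d = p / \<alpha> - cnj (q / \<alpha>)"
  \<comment> \<open>The cross term divided by \<alpha> has the imaginary part of \<omega> d, so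
    \<omega> is the phase that turns d into \<open>cmod d\<close>.\<close>
  define \<omega> where "\<omega> = (if d = 0 then 1 else cnj (sgn d))"
  have "cmod \<omega> = 1" by (simp add: \<omega>_def norm_sgn)
  then have \<omega>: "\<omega> * cnj \<omega> = 1" using complex_norm_square[of \<omega>] by simp
  define r where "r = Re (\<omega> * (p / \<alpha>) + cnj \<omega> * (q / \<alpha>))"
  have "Im (\<omega> * (p / \<alpha>) + cnj \<omega> * (q / \<alpha>)) = Im (\<omega> * d)"
  proof -
    have "Im (\<omega> * x + cnj \<omega> * y) = Im (\<omega> * (x - cnj y))" for x y
      by (simp add: right_diff_distrib)
    then show ?thesis unfolding d_def .
  qed
  also have "\<omega> * d = of_real (cmod d)"
  proof (cases "d = 0")
    case False
    then have "\<omega> * d = d * cnj d / of_real (cmod d)"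
      by (simp add: \<omega>_def sgn_eq mult.commute)
    also have "\<dots> = of_real (cmod d)"
      using False unfolding complex_norm_square[symmetric] by (simp add: power2_eq_square)
    finally show ?thesis .
  qed (simp add: \<omega>_def)
  finally have "\<omega> * (p / \<alpha>) + cnj \<omega> * (q / \<alpha>) = of_real r"
    by (simp add: complex_eq_iff r_def)
  then have cross: "\<omega> * p + cnj \<omega> * q = of_real r * \<alpha>"
    using False by (simp add: field_simps)
  define f where "f \<tau> = a * (cos \<tau>)\<^sup>2 - t * (sin \<tau>)\<^sup>2 + r * (sin \<tau> * cos \<tau>)" for \<tau>
  have "continuous_on {0..pi/2} f" unfolding f_def by (intro continuous_intros)
  then obtain \<tau> where \<tau>: "f \<tau> = 0"
    using IVT2'[of f "pi/2" 0 0] a(1) t(1) by (auto simp: f_def)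
  define C S where "C = complex_of_real (cos \<tau>)" and "S = complex_of_real (sin \<tau>)"
  have CS: "C * C + S * S = 1"
    unfolding C_def S_def of_real_mult[symmetric] of_real_add[symmetric]
    using sin_cos_squared_add2[of \<tau>] by (simp add: power2_eq_square)
  have cnjCS: "cnj C = C" "cnj S = S" by (simp_all add: C_def S_def)
  have f0: "of_real a * (C * C) - of_real t * (S * S) + of_real r * (S * C) = 0"
    using \<tau> unfolding f_def C_def S_def
    by (simp add: power2_eq_square flip: of_real_mult of_real_add of_real_diff)
  have n: "cinner u u = 1" "cinner w w = 1" "cinner u w = 0" "cinner w u = 0"
    using orthonormal_cinner[OF uw(1)] uw(2) by auto
  define g v where "g = scaleC C u + scaleC (S * \<omega>) w" and "v = scaleC (- (S * cnj \<omega>)) u + scaleC C w"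
  note exp = cinner_add_left cinner.add_right cinner_scaleC_left cinner_scaleC_right
  have gg: "cinner g g = 1"
  proof -
    have "cinner g g = C * C + S * S * (\<omega> * cnj \<omega>)"
      by (simp add: g_def exp n cnjCS)
    then show ?thesis using CS \<omega> by simp
  qed
  have vv: "cinner v v = 1"
  proof -
    have "cinner v v = C * C + S * S * (\<omega> * cnj \<omega>)"
      by (simp only: v_def exp n cnjCS complex_cnj_minus complex_cnj_mult complex_cnj_cnj)
        (simp add: algebra_simps)
    then show ?thesis using CS \<omega> by simp
  qed
  have gv: "cinner g v = 0"
    by (simp only: g_def v_def exp n cnjCS complex_cnj_minus complex_cnj_mult complex_cnj_cnj)
      (simp add: algebra_simps)
  have ne: "g \<noteq> v" using gg gv by auto
  have "orthonormal {g, v}"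
    using gg vv gv cinner_eq_0_commute[of g v] by (auto simp: orthonormal_def)
  moreover have "{g, v} \<subseteq> cspan {u, w}"
    unfolding g_def v_def by (simp only: empty_subsetI insert_subset cspan_pair_combination)
  moreover have "{u, w} \<subseteq> cspan {g, v}"
  proof -
    have "u = scaleC C g + scaleC (- (S * \<omega>)) v"
    proof -
      have "scaleC C g + scaleC (- (S * \<omega>)) v = scaleC (C * C + S * S * (\<omega> * cnj \<omega>)) u
          + scaleC (C * (S * \<omega>) - S * \<omega> * C) w"
        unfolding g_def v_def scaleC_add_right scaleC_scaleC complex_vector.scale_left_diff_distrib
          scaleC_add_left by (simp add: mult_ac)
      then show ?thesis using CS \<omega> complex_vector.scale_one[of u] by (simp add: mult_ac)
    qed
    moreover have "w = scaleC (S * cnj \<omega>) g + scaleC C v"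
    proof -
      have "scaleC (S * cnj \<omega>) g + scaleC C v = scaleC (S * cnj \<omega> * C - C * (S * cnj \<omega>)) u
          + scaleC (S * S * (\<omega> * cnj \<omega>) + C * C) w"
        unfolding g_def v_def scaleC_add_right scaleC_scaleC complex_vector.scale_left_diff_distrib
          scaleC_add_left by (simp add: mult_ac)
      then show ?thesis using CS \<omega> complex_vector.scale_one[of w] by (simp add: mult_ac add.commute)
    qed
    ultimately show ?thesis
      by (metis cspan_pair_combination empty_subsetI insert_subset)
  qed
  moreover have Dg: "cinner (D g) g = 0"
  proof -
    have "cinner (D g) g = C * C * cinner (D u) u + S * C * (\<omega> * p + cnj \<omega> * q)
        + S * S * (\<omega> * cnj \<omega>) * cinner (D w) w"
      by (simp add: g_def bounded_clinear_combination[OF D] exp cnjCS p_def q_def algebra_simps)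
    also have "\<dots> = (of_real a * (C * C) - of_real t * (S * S) + of_real r * (S * C)) * \<alpha>"
      unfolding a(2) t(2) cross \<omega> by (simp add: algebra_simps)
    finally show ?thesis using f0 by simp
  qed
  moreover have "cinner (D v) v = of_real (a - t) * \<alpha>"
  proof -
    have "cinner (D v) v = S * S * (\<omega> * cnj \<omega>) * cinner (D u) u - S * C * (\<omega> * p + cnj \<omega> * q)
        + C * C * cinner (D w) w"
      by (simp only: v_def bounded_clinear_combination[OF D] exp cnjCS p_def q_def complex_cnj_minus
          complex_cnj_mult complex_cnj_cnj) (simp add: algebra_simps)
    \<comment> \<open>Invariance of the trace on the plane: the first summand is the trace, the
      second the entry at g, which is 0.\<close>
    also have "\<dots> = of_real (a - t) * \<alpha> * (C * C + S * S)
        - (of_real a * (C * C) - of_real t * (S * S) + of_real r * (S * C)) * \<alpha>"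
      unfolding a(2) t(2) cross \<omega> by (simp add: algebra_simps)
    finally show ?thesis using f0 CS by simp
  qed
  ultimately show thesis using ne that by blast
qed

lemma cspan_subset: "A \<subseteq> cspan B \<Longrightarrow> cspan A \<subseteq> cspan B"
  by (simp add: complex_vector.span_minimal)

text \<open>The entry at u is a reserve that balances W. A rotation against w splits off a vector g
  with entry 0 and hands the reserve, diminished by \<open>t w\<close>, to v, which replaces u; once
  W is exhausted the reserve is 0. Non-negativity of t keeps the reserve on the side that the next
  rotation requires.\<close>

lemma zero_diagonal_on_finite_span:
  assumes D: "bounded_clinear D" and "finite W"
    and "u \<notin> W" "orthonormal (insert u W)"
    and "\<And>w. w \<in> W \<Longrightarrow> 0 \<le> t w" "\<And>w. w \<in> W \<Longrightarrow> cinner (D w) w = - (of_real (t w) * \<alpha>)"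
    and "cinner (D u) u = of_real (\<Sum>w\<in>W. t w) * \<alpha>"
  shows "\<exists>G. finite G \<and> orthonormal G \<and> G \<subseteq> cspan (insert u W) \<and> insert u W \<subseteq> cspan G
    \<and> (\<forall>g\<in>G. cinner (D g) g = 0)"
  using assms(2-)
proof (induction W arbitrary: u rule: finite_induct)
  case empty
  then show ?case by (intro exI[of _ "{u}"]) (auto simp: complex_vector.span_base)
next
  case (insert w W)
  note o = insert.prems(2)
  have uw: "orthonormal {u, w}" "u \<noteq> w"
    using orthonormal_subset[OF o, of "{u, w}"] insert.prems(1) by auto
  have a: "0 \<le> (\<Sum>x\<in>insert w W. t x)" using insert.prems(3) by (intro sum_nonneg)
  obtain g v where gv: "orthonormal {g, v}" "g \<noteq> v" "{g, v} \<subseteq> cspan {u, w}" "{u, w} \<subseteq> cspan {g, v}"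
    "cinner (D g) g = 0" "cinner (D v) v = of_real ((\<Sum>x\<in>insert w W. t x) - t w) * \<alpha>"
    by (rule rotate_pair[OF D uw a insert.prems(5) insert.prems(3)[of w] insert.prems(4)[of w]]) auto
  have orth: "cinner y x = 0" if x: "x \<in> W" and y: "y \<in> {g, v}" for x y
  proof -
    have "cinner x s = 0" if "s \<in> {u, w}" for s
      using that x insert.hyps(2) insert.prems(1) orthonormal_cinner[OF o, of x s] by auto
    moreover have "y \<in> cspan {u, w}" using gv(3) y by blast
    ultimately have "cinner x y = 0" by (rule cinner_cspan_eq_0)
    then show ?thesis by (simp add: cinner_eq_0_commute[of y])
  qed
  have ng: "norm g = 1" and nv: "norm v = 1" using orthonormal_norm[OF gv(1)] by auto
  have oW: "orthonormal W" by (rule orthonormal_subset[OF o]) blast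
  have ov: "orthonormal (insert v W)" by (rule orthonormal_insert_iff[OF oW _ nv]) (simp add: orth)
  have vW: "v \<notin> W" using orth[of v v] nv by (auto simp: cinner_self)
  have "cinner (D v) v = of_real (\<Sum>x\<in>W. t x) * \<alpha>" using gv(6) insert.hyps by simp
  then obtain G where G: "finite G" "orthonormal G" "G \<subseteq> cspan (insert v W)" "insert v W \<subseteq> cspan G"
    "\<forall>g\<in>G. cinner (D g) g = 0"
    using insert.IH[OF vW ov] insert.prems(3,4) by auto
  have og: "cinner g x = 0" if "x \<in> G" for x
  proof (rule cinner_cspan_eq_0)
    show "x \<in> cspan (insert v W)" using G(3) that by blast
    show "cinner g s = 0" if "s \<in> insert v W" for s
      using that orth[of s g] orthonormal_cinner[OF gv(1), of g v] gv(2) by auto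
  qed
  have sub1: "cspan {u, w} \<subseteq> cspan (insert u (insert w W))" by (intro complex_vector.span_mono) auto
  have "insert v W \<subseteq> cspan (insert u (insert w W))"
    using gv(3) sub1 complex_vector.span_superset[of "insert u (insert w W)"] by auto
  then have "cspan (insert v W) \<subseteq> cspan (insert u (insert w W))" by (rule cspan_subset)
  then have 1: "insert g G \<subseteq> cspan (insert u (insert w W))" using gv(3) sub1 G(3) by auto
  have sub2: "cspan G \<subseteq> cspan (insert g G)" by (intro complex_vector.span_mono) auto
  have "{g, v} \<subseteq> cspan (insert g G)"
    using sub2 G(4) complex_vector.span_superset[of "insert g G"] by auto
  then have "cspan {g, v} \<subseteq> cspan (insert g G)" by (rule cspan_subset)
  then have 2: "insert u (insert w W) \<subseteq> cspan (insert g G)" using gv(4) G(4) sub2 by auto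
  show ?case
    using 1 2 G(1,5) gv(5) orthonormal_insert_iff[OF G(2) og ng]
    by (intro exI[of _ "insert g G"]) auto
qed

section \<open>Finite systems with prescribed trace\<close>

lemma bounded_clinear_expansion:
  assumes T: "bounded_clinear T"
  shows "bounded_clinear (\<lambda>x. \<Sum>g\<in>G. scaleC (cinner (T x) g) g)"
proof -
  have "bounded_linear (\<lambda>x. scaleC (cinner (T x) g) g)" for g
    by (rule bounded_linear_compose[OF scaleC.bounded_linear_left bounded_clinear_cinner(1)[OF T]])
  then have "bounded_linear (\<lambda>x. \<Sum>g\<in>G. scaleC (cinner (T x) g) g)"
    by (intro bounded_linear_sum)
  moreover have "(\<Sum>g\<in>G. scaleC (cinner (T (scaleC a x)) g) g)
      = scaleC a (\<Sum>g\<in>G. scaleC (cinner (T x) g) g)" for a x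
    unfolding scaleC.sum_right bounded_clinear_cinner(2)[OF T] scaleC_scaleC ..
  ultimately show ?thesis by (simp add: bounded_clinear_def)
qed

text \<open>The functional (Tx, g) is bounded, so its square sums over orthonormal sets are too.
  Hence cutting finitely many directions out of the range cannot repair a divergent Hilbert-Schmidt
  sum.\<close>

lemma sum_cinner_bounded_clinear_le:
  fixes T :: "'a::complex_inner \<Rightarrow> 'a"
  assumes T: "bounded_clinear T" and E: "finite E" "orthonormal E"
  shows "(\<Sum>e\<in>E. (cmod (cinner (T e) g))\<^sup>2) \<le> (onorm T * norm g)\<^sup>2"
proof -
  have "bounded_linear T" using T by (simp add: bounded_clinear_def)
  then have "cmod (cinner (T x) g) \<le> onorm T * norm g * norm x" for x
    using cauchy_schwarz_cinner[of "T x" g] mult_right_mono[OF onorm[of T x], of "norm g"]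
    by (simp add: mult_ac)
  then have le: "(cmod (cinner (T x) g))\<^sup>2 \<le> (onorm T * norm g)\<^sup>2 * (norm x)\<^sup>2" for x
    unfolding power_mult_distrib[symmetric] by (intro power_mono) auto
  show ?thesis
    by (rule sum_functional_le[OF bounded_clinear_cinner[OF T] complex_vector.subspace_UNIV le _ E]) auto
qed

text \<open>The components of W in the complement and in the kernel lie in the spans of
  \<open>G1\<close> and \<open>G2\<close>; \<open>G1\<close> is removed from the domain and
  \<open>G2\<close> from the range. Both removals change Hilbert-Schmidt sums by a bounded amount,
  so the truncated operator A still has arbitrarily large finite sums, and a singular system of A
  with normalised images gives the pairs.\<close>

lemma non_hilbert_schmidt_pairs:
  fixes D :: "'a::complex_hilbert \<Rightarrow> 'a"
  assumes D: "is_idempotent D"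
    and nHS: "\<not> hilbert_schmidt_on (corthogonal (ker D)) (nilpotent_part D)" and W: "finite W"
  obtains X y c where "finite X" "orthonormal X" "X \<subseteq> corthogonal (ker D)"
    "inj_on y X" "orthonormal (y ` X)" "y ` X \<subseteq> ker D"
    "\<And>x w. x \<in> X \<Longrightarrow> w \<in> W \<Longrightarrow> cinner x w = 0 \<and> cinner (y x) w = 0"
    "\<And>x. x \<in> X \<Longrightarrow> 0 < c x \<and> cinner (D x) (y x) = of_real (c x)"
    "R \<le> (\<Sum>x\<in>X. (c x)\<^sup>2)"
proof -
  note Db = idempotent_bounded_clinear[OF D]
  note ker = bounded_clinear_ker[OF Db]
  obtain P where P: "is_projection P" "\<And>x. P x \<in> corthogonal (ker D)" "\<And>x. x - P x \<in> ker D"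
    using complement_projection_exists[OF ker] by metis
  obtain G1 where G1: "finite G1" "orthonormal G1" "G1 \<subseteq> corthogonal (ker D)" "P ` W \<subseteq> cspan G1"
    by (rule gram_schmidt[OF subspace_corthogonal finite_imageI[OF W] image_subsetI[OF P(2)]
          finite.emptyI orthonormal_empty empty_subsetI])
  obtain G2 where G2: "finite G2" "orthonormal G2" "G2 \<subseteq> ker D" "(\<lambda>w. w - P w) ` W \<subseteq> cspan G2"
    by (rule gram_schmidt[OF ker(2) finite_imageI[OF W] image_subsetI[OF P(3)]
          finite.emptyI orthonormal_empty empty_subsetI])
  obtain E where E: "orthonormal_basis (corthogonal (ker D)) E" "G1 \<subseteq> E"
    by (rule orthonormal_basis_extend[OF closed_corthogonal subspace_corthogonal G1(2,3)])
  have oE: "orthonormal E" using E by (simp add: orthonormal_basis_iff)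
  define T where "T x = D x - x" for x
  have T: "bounded_clinear T"
    unfolding T_def by (intro bounded_clinear_diff Db bounded_clinear_id)
  have Tker: "T x \<in> ker D" for x unfolding T_def by (rule idempotent_diff_in_ker[OF D])
  \<comment> \<open>T followed by the projection off \<open>G2\<close>: the values stay in the
    kernel of D and become orthogonal to \<open>G2\<close>.\<close>
  define A where "A x = T x - (\<Sum>g\<in>G2. scaleC (cinner (T x) g) g)" for x
  have A: "bounded_clinear A"
    unfolding A_def by (intro bounded_clinear_diff T bounded_clinear_expansion)
  interpret A: bounded_linear A using A by (simp add: bounded_clinear_def)
  have AG2: "cinner (A x) g = 0" if "g \<in> G2" for x g
    unfolding A_def cinner.diff_left using that by (simp add: cinner_sum_orthonormal G2)
  have Aker: "A x \<in> ker D" for x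
    unfolding A_def using G2(3) Tker
    by (intro complex_vector.subspace_diff[OF ker(2)] complex_vector.subspace_sum[OF ker(2)]
        complex_vector.subspace_scale[OF ker(2)]) auto
  have nT: "(norm (T x))\<^sup>2 = (norm (A x))\<^sup>2 + (\<Sum>g\<in>G2. (cmod (cinner (T x) g))\<^sup>2)" for x
    unfolding A_def bessel_diff[OF G2(1,2)] by simp
  define B where "B = (\<Sum>g\<in>G2. (onorm T * norm g)\<^sup>2)"
  have "\<exists>F. finite F \<and> F \<subseteq> E - G1 \<and> R < (\<Sum>e\<in>F. (norm (A e))\<^sup>2)"
  proof (rule ccontr)
    assume "\<not> ?thesis"
    then have R: "(\<Sum>e\<in>F. (norm (A e))\<^sup>2) \<le> R" if "finite F" "F \<subseteq> E - G1" for F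
      using that by (meson not_le)
    have "(\<Sum>e\<in>F. (norm (T e))\<^sup>2) \<le> (\<Sum>e\<in>G1. (norm (T e))\<^sup>2) + (R + B)" if F: "finite F" "F \<subseteq> E" for F
    proof -
      have oF: "orthonormal (F - G1)" by (rule orthonormal_subset[OF oE]) (use F in blast)
      have "(\<Sum>e\<in>F. (norm (T e))\<^sup>2) \<le> (\<Sum>e\<in>G1 \<union> (F - G1). (norm (T e))\<^sup>2)"
        using F(1) G1(1) by (intro sum_mono2) auto
      also have "\<dots> = (\<Sum>e\<in>G1. (norm (T e))\<^sup>2) + (\<Sum>e\<in>F - G1. (norm (T e))\<^sup>2)"
        using F(1) G1(1) by (intro sum.union_disjoint) auto
      also have "(\<Sum>e\<in>F - G1. (norm (T e))\<^sup>2)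
          = (\<Sum>e\<in>F - G1. (norm (A e))\<^sup>2) + (\<Sum>g\<in>G2. \<Sum>e\<in>F - G1. (cmod (cinner (T e) g))\<^sup>2)"
        unfolding nT sum.distrib by (subst (2) sum.swap) (rule refl)
      also have "\<dots> \<le> R + B"
        unfolding B_def using F oF
        by (intro add_mono R sum_mono sum_cinner_bounded_clinear_le[OF T]) auto
      finally show ?thesis by simp
    qed
    then have "(\<lambda>e. (norm (T e))\<^sup>2) summable_on E"
      by (intro nonneg_bdd_above_summable_on bdd_aboveI[of _ "(\<Sum>e\<in>G1. (norm (T e))\<^sup>2) + (R + B)"]) auto
    then show False
      using nHS E(1) unfolding hilbert_schmidt_on_nilpotent_part_iff[OF D] T_def by blast
  qed
  then obtain F where F: "finite F" "F \<subseteq> E - G1" "R < (\<Sum>e\<in>F. (norm (A e))\<^sup>2)" by blast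
  have oF: "orthonormal F" by (rule orthonormal_subset[OF oE]) (use F in blast)
  obtain X0 where X0: "finite X0" "orthonormal X0" "X0 \<subseteq> cspan F"
    "\<And>x z. x \<in> X0 \<Longrightarrow> z \<in> X0 \<Longrightarrow> x \<noteq> z \<Longrightarrow> cinner (A x) (A z) = 0"
    "(\<Sum>e\<in>F. (norm (A e))\<^sup>2) \<le> (\<Sum>x\<in>X0. (norm (A x))\<^sup>2)"
    by (rule finite_singular_system[OF A F(1) oF]) blast
  \<comment> \<open>Vectors killed by A have no normalised image; dropping them leaves the sum
    unchanged.\<close>
  define X where "X = {x \<in> X0. A x \<noteq> 0}"
  define c where "c x = norm (A x)" for x
  define y where "y x = scaleC (of_real (inverse (c x))) (A x)" for x
  have XX: "X \<subseteq> X0" by (auto simp: X_def)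
  have c: "0 < c x" if "x \<in> X" for x using that by (simp add: c_def X_def)
  have yy: "cinner (y x) (y z) = (if x = z then 1 else 0)" if "x \<in> X" "z \<in> X" for x z
  proof (cases "x = z")
    case True
    then show ?thesis using c[OF that(1)]
      by (simp add: y_def cinner_self norm_scaleC norm_inverse c_def[symmetric])
  next
    case False
    then show ?thesis using X0(4)[of x z] that XX
      by (auto simp: y_def cinner_scaleC_left cinner_scaleC_right)
  qed
  have "F \<subseteq> corthogonal (ker D)" using F(2) orthonormal_basis_mem[OF E(1)] by blast
  then have "cspan F \<subseteq> corthogonal (ker D)"
    by (intro complex_vector.span_minimal subspace_corthogonal)
  then have XL: "X \<subseteq> corthogonal (ker D)" using X0(3) XX by blast
  have yker: "y x \<in> ker D" for x
    unfolding y_def using Aker by (rule complex_vector.subspace_scale[OF ker(2)])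
  have cross: "cinner x k = 0" "cinner k x = 0" if "x \<in> corthogonal (ker D)" "k \<in> ker D" for x k
    using that cinner_eq_0_commute[of k x] by (auto simp: corthogonal_def)
  have FG1: "cinner f g = 0" if "f \<in> F" "g \<in> G1" for f g
  proof -
    have "f \<in> E" "g \<in> E" "f \<noteq> g" using that F(2) E(2) by blast+
    then show ?thesis using orthonormal_cinner[OF oE] by simp
  qed
  have xw: "cinner x w = 0" if x: "x \<in> X" and w: "w \<in> W" for x w
  proof -
    have "cinner x g = 0" if g: "g \<in> G1" for g
    proof -
      have "cinner g x = 0"
        using X0(3) XX x FG1[OF _ g]
        by (intro cinner_cspan_eq_0[of F g x]) (auto simp: cinner_eq_0_commute[of g])
      then show ?thesis by (simp add: cinner_eq_0_commute[of x])
    qed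
    then have "cinner x (P w) = 0" using G1(4) w by (intro cinner_cspan_eq_0[of G1 x "P w"]) auto
    moreover have "cinner x (w - P w) = 0" using cross(1)[of x "w - P w"] XL x P(3) by blast
    ultimately show ?thesis by (simp add: cinner.diff_right)
  qed
  have yw: "cinner (y x) w = 0" if w: "w \<in> W" for x w
  proof -
    have "cinner (y x) g = 0" if "g \<in> G2" for g
      using AG2[OF that] by (simp add: y_def cinner_scaleC_left)
    then have "cinner (y x) (w - P w) = 0"
      using G2(4) w by (intro cinner_cspan_eq_0[of G2 "y x" "w - P w"]) auto
    moreover have "cinner (y x) (P w) = 0" using cross(2) P(2) yker by blast
    ultimately show ?thesis by (simp add: cinner.diff_right)
  qed
  have Dxy: "cinner (D x) (y x) = of_real (c x)" if x: "x \<in> X" for x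
  proof -
    have "D x = x + (A x + (\<Sum>g\<in>G2. scaleC (cinner (T x) g) g))" by (simp add: A_def T_def)
    moreover have "cinner x (y x) = 0" using cross(1) XL x yker by blast
    moreover have "cinner (\<Sum>g\<in>G2. scaleC (cinner (T x) g) g) (y x) = 0"
    proof -
      have "cinner g (y x) = 0" if "g \<in> G2" for g
        using AG2[OF that, of x] cinner_eq_0_commute[of g "A x"]
        by (simp add: y_def cinner_scaleC_right)
      then show ?thesis by (simp add: cinner.sum_left cinner_scaleC_left)
    qed
    ultimately have "cinner (D x) (y x) = cinner (A x) (y x)" by (simp only: cinner_add_left) simp
    also have "\<dots> = of_real (c x)"
      using c[OF x] by (simp add: y_def cinner_scaleC_right cinner_self c_def[symmetric] power2_eq_square)
    finally show ?thesis .
  qed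
  have "(\<Sum>x\<in>X0. (norm (A x))\<^sup>2) = (\<Sum>x\<in>X. (c x)\<^sup>2)"
    unfolding c_def X_def using X0(1) by (intro sum.mono_neutral_right) auto
  then have R: "R \<le> (\<Sum>x\<in>X. (c x)\<^sup>2)" using F(3) X0(5) by simp
  show thesis
  proof (rule that[of X y c])
    show "finite X" "orthonormal X"
      using X0(1) XX finite_subset orthonormal_subset[OF X0(2)] by blast+
    show "inj_on y X"
      using yy by (intro inj_onI) (metis zero_neq_one)
    then show "orthonormal (y ` X)" unfolding orthonormal_def using yy by (auto simp: inj_on_eq_iff)
  qed (use XL yker xw yw c Dxy R in auto)
qed

text \<open>With Q the sum of all c^2, the pair at x is asked for the share c^2 / Q of s. Its disc
  has radius c^2 / (16 N), so every share fits as soon as Q >= 16 N |s|, and such Q are available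
  because the nilpotent part is not Hilbert-Schmidt.\<close>

lemma prescribed_finite_trace:
  fixes D :: "'a::complex_hilbert \<Rightarrow> 'a"
  assumes D: "is_idempotent D"
    and nHS: "\<not> hilbert_schmidt_on (corthogonal (ker D)) (nilpotent_part D)" and W: "finite W"
  obtains X t where "finite X" "orthonormal X" "\<And>x w. x \<in> X \<Longrightarrow> w \<in> W \<Longrightarrow> cinner x w = 0"
    "\<And>x. x \<in> X \<Longrightarrow> 0 \<le> t x" "(\<Sum>x\<in>X. t x) = (1::real)"
    "\<And>x. x \<in> X \<Longrightarrow> cinner (D x) x = of_real (t x) * s"
proof -
  note Db = idempotent_bounded_clinear[OF D]
  interpret D: bounded_linear D using Db by (simp add: bounded_clinear_def)
  \<comment> \<open>\<open>disc_parameters\<close> wants N >= 1 and c <= N; as c is a matrix entry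
    of D at unit vectors, the operator norm plus 1 serves.\<close>
  define N where "N = onorm D + 1"
  have N: "1 \<le> N" using onorm_pos_le[OF D.bounded_linear] by (simp add: N_def)
  obtain X y c where X: "finite X" "orthonormal X" "X \<subseteq> corthogonal (ker D)"
    and y: "inj_on y X" "orthonormal (y ` X)" "y ` X \<subseteq> ker D"
    and orth: "\<And>x w. x \<in> X \<Longrightarrow> w \<in> W \<Longrightarrow> cinner x w = 0 \<and> cinner (y x) w = 0"
    and c: "\<And>x. x \<in> X \<Longrightarrow> 0 < c x \<and> cinner (D x) (y x) = of_real (c x)"
    and Q: "16 * N * cmod s + 1 \<le> (\<Sum>x\<in>X. (c x)\<^sup>2)"
    by (rule non_hilbert_schmidt_pairs[OF D nHS W]) blast
  define Q where "Q = (\<Sum>x\<in>X. (c x)\<^sup>2)"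
  \<comment> \<open>The extra 1 in the lower bound keeps Q positive for s = 0, so that division by Q
    is legitimate.\<close>
  have Q0: "Q > 0" and Qs: "16 * N * cmod s \<le> Q"
  proof -
    have "0 \<le> 16 * N * cmod s" using N by simp
    with Q show "Q > 0" "16 * N * cmod s \<le> Q" unfolding Q_def by linarith+
  qed
  define z where "z x = of_real ((c x)\<^sup>2 / Q) * s" for x
  have "\<exists>b \<omega>. 0 \<le> b \<and> b \<le> 1 \<and> cmod \<omega> = 1 \<and>
      of_real (b\<^sup>2) + of_real (b * sqrt (1 - b\<^sup>2) * c x) * \<omega> = z x" if x: "x \<in> X" for x
  proof -
    have "y x \<in> y ` X" using x by blast
    then have "cmod (cinner (D x) (y x)) \<le> norm (D x)"
      using cauchy_schwarz_cinner[of "D x" "y x"] orthonormal_norm[OF y(2)] by simp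
    also have "\<dots> \<le> onorm D" using onorm[OF D.bounded_linear, of x] orthonormal_norm[OF X(2) x] by simp
    finally have cN: "c x \<le> N" using c[OF x] by (simp add: N_def)
    have "cmod (z x) = (c x)\<^sup>2 * cmod s / Q" using Q0 by (simp add: z_def norm_mult norm_divide norm_power)
    also have "\<dots> \<le> (c x)\<^sup>2 / (16 * N)"
    proof -
      have "(c x)\<^sup>2 * (16 * N * cmod s) \<le> (c x)\<^sup>2 * Q" using Qs by (intro mult_left_mono) auto
      then show ?thesis using Q0 N by (simp add: field_simps)
    qed
    finally have "cmod (z x) \<le> (c x)\<^sup>2 / (16 * N)" .
    then show ?thesis using disc_parameters[of "c x" N "z x"] c[OF x] cN N by metis
  qed
  then obtain b \<omega> where b: "\<And>x. x \<in> X \<Longrightarrow> 0 \<le> b x \<and> b x \<le> 1 \<and> cmod (\<omega> x) = 1 \<and>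
      of_real ((b x)\<^sup>2) + of_real (b x * sqrt (1 - (b x)\<^sup>2) * c x) * \<omega> x = z x" by metis
  define r where "r x = sqrt (1 - (b x)\<^sup>2)" for x
  have r: "(r x)\<^sup>2 = 1 - (b x)\<^sup>2" if "x \<in> X" for x
  proof -
    have "(b x)\<^sup>2 \<le> 1" using b[OF that] by (simp add: power_le_one)
    then show ?thesis by (simp add: r_def)
  qed
  \<comment> \<open>D kills \<open>y x\<close> and maps x to x plus a kernel vector, so the form at
    \<open>v x\<close> is b^2 + b r c \<omega>, the expression already matched with
    \<open>z x\<close>.\<close>
  define v where "v x = scaleC (of_real (b x) * \<omega> x) x + scaleC (of_real (r x)) (y x)" for x
  have cross: "cinner x (y x') = 0" "cinner (y x') x = 0" if "x \<in> X" "x' \<in> X" for x x'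
    using that X(3) y(3) cinner_eq_0_commute[of "y x'" x] by (auto simp: corthogonal_def image_subset_iff)
  have \<omega>: "\<omega> x * cnj (\<omega> x) = 1" if "x \<in> X" for x
    using b[OF that] complex_norm_square[of "\<omega> x"] by simp
  note exp = cinner_add_left cinner.add_right cinner_scaleC_left cinner_scaleC_right
  have vv: "cinner (v x) (v x') = (if x = x' then 1 else 0)" if xx: "x \<in> X" "x' \<in> X" for x x'
  proof -
    have 1: "cinner x x' = (if x = x' then 1 else 0)" using orthonormal_cinner[OF X(2) xx] .
    have 2: "cinner (y x) (y x') = (if x = x' then 1 else 0)"
      using orthonormal_cinner[OF y(2), of "y x" "y x'"] y(1) xx by (auto simp: inj_on_eq_iff)
    have 3: "cinner x (y x') = 0" "cinner (y x) x' = 0" using cross xx by blast+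
    show ?thesis
    proof (cases "x = x'")
      case True
      have "cinner (v x) (v x) = of_real ((b x)\<^sup>2) * (\<omega> x * cnj (\<omega> x)) + of_real ((r x)\<^sup>2)"
        using 1 2 3 True unfolding v_def exp by (simp add: power2_eq_square)
      also have "\<dots> = 1" unfolding \<omega>[OF xx(1)] r[OF xx(1)] by simp
      finally show ?thesis using True by simp
    next
      case False
      then show ?thesis unfolding v_def exp using 1 2 3 by simp
    qed
  qed
  have Dv: "cinner (D (v x)) (v x) = z x" if x: "x \<in> X" for x
  proof -
    have Dy: "D (y x) = 0" using y(3) x by (auto simp: ker_def image_subset_iff)
    have "cinner (D x - x) x = 0"
    proof -
      have "cinner x (D x - x) = 0"
        using X(3) x idempotent_diff_in_ker[OF D, of x] by (auto simp: corthogonal_def)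
      then show ?thesis by (simp only: cinner_eq_0_commute[of "D x - x"])
    qed
    then have Dx: "cinner (D x) x = 1"
      using orthonormal_cinner[OF X(2) x x] by (simp add: cinner.diff_left)
    have "D (v x) = scaleC (of_real (b x) * \<omega> x) (D x)"
      unfolding v_def bounded_clinear_combination[OF Db] Dy by (simp add: scaleC.zero_right)
    then have "cinner (D (v x)) (v x)
        = of_real (b x) * \<omega> x * (cnj (of_real (b x) * \<omega> x) * 1 + of_real (r x) * of_real (c x))"
      using c[OF x] Dx by (simp add: v_def exp algebra_simps)
    also have "\<dots> = of_real ((b x)\<^sup>2) * (\<omega> x * cnj (\<omega> x)) + of_real (b x * r x * c x) * \<omega> x"
      by (simp add: power2_eq_square algebra_simps)
    also have "\<dots> = z x" using \<omega>[OF x] b[OF x] by (simp add: r_def)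
    finally show ?thesis .
  qed
  have inj: "inj_on v X" using vv by (intro inj_onI) (metis zero_neq_one)
  define t where "t u = (c (the_inv_into X v u))\<^sup>2 / Q" for u
  have t: "t (v x) = (c x)\<^sup>2 / Q" if "x \<in> X" for x
    by (simp add: t_def the_inv_into_f_f[OF inj that])
  show thesis
  proof (rule that[of "v ` X" t])
    show "finite (v ` X)" using X(1) by simp
    show "orthonormal (v ` X)" unfolding orthonormal_def using vv inj by (auto simp: inj_on_eq_iff)
    show "cinner u w = 0" if "u \<in> v ` X" "w \<in> W" for u w
      using that orth by (auto simp: v_def exp)
    show "0 \<le> t u" for u using Q0 by (simp add: t_def)
    have "(\<Sum>u\<in>v ` X. t u) = (\<Sum>x\<in>X. (c x)\<^sup>2 / Q)"
      using t by (simp add: sum.reindex[OF inj])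
    also have "\<dots> = 1" using Q0 by (simp add: Q_def flip: sum_divide_distrib)
    finally show "(\<Sum>u\<in>v ` X. t u) = 1" .
    show "cinner (D u) u = of_real (t u) * s" if "u \<in> v ` X" for u
      using that Dv t by (auto simp: z_def)
  qed
qed

section \<open>Extension to bases with vanishing further diagonal\<close>

text \<open>Gram-Schmidt brings v into the span at the price of a vector u with uncontrolled
  diagonal entry. A system X orthogonal to u and F, of total diagonal -(Du, u), compensates it; only
  the span of u and X receives a new basis, and F stays.\<close>

lemma zero_diagonal_extension_step:
  fixes D :: "'a::complex_hilbert \<Rightarrow> 'a"
  assumes D: "is_idempotent D"
    and nHS: "\<not> hilbert_schmidt_on (corthogonal (ker D)) (nilpotent_part D)"
    and F: "finite F" "orthonormal F"
  shows "\<exists>F'. finite F' \<and> orthonormal F' \<and> F \<subseteq> F' \<and> v \<in> cspan F'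
    \<and> (\<forall>f\<in>F' - F. cinner (D f) f = 0)"
proof (cases "v \<in> cspan F")
  case True
  then show ?thesis using F by blast
next
  case False
  obtain u where u: "u \<notin> F" "orthonormal (insert u F)" "v \<in> cspan (insert u F)"
    by (rule gram_schmidt_step[OF F False])
  have fin: "finite (insert u F)" using F(1) by simp
  obtain X t where X: "finite X" "orthonormal X"
    "\<And>x w. x \<in> X \<Longrightarrow> w \<in> insert u F \<Longrightarrow> cinner x w = 0"
    and t: "\<And>x. x \<in> X \<Longrightarrow> 0 \<le> t x" "(\<Sum>x\<in>X. t x) = (1::real)"
    "\<And>x. x \<in> X \<Longrightarrow> cinner (D x) x = of_real (t x) * (- cinner (D u) u)"
    by (rule prescribed_finite_trace[OF D nHS fin]) blast
  have nu: "norm u = 1" using orthonormal_norm[OF u(2)] by simp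
  have ux: "cinner u x = 0" if "x \<in> X" for x
    using X(3)[OF that, of u] cinner_eq_0_commute[of u x] by simp
  have uX: "u \<notin> X" using ux[of u] nu by (auto simp: cinner_self)
  have oX: "orthonormal (insert u X)" by (rule orthonormal_insert_iff[OF X(2) ux nu])
  have "\<exists>G. finite G \<and> orthonormal G \<and> G \<subseteq> cspan (insert u X) \<and> insert u X \<subseteq> cspan G
    \<and> (\<forall>g\<in>G. cinner (D g) g = 0)"
    by (rule zero_diagonal_on_finite_span[where t = t and \<alpha> = "cinner (D u) u",
          OF idempotent_bounded_clinear[OF D] X(1) uX oX]) (use t in auto)
  then obtain G where G: "finite G" "orthonormal G" "G \<subseteq> cspan (insert u X)" "insert u X \<subseteq> cspan G"
    "\<forall>g\<in>G. cinner (D g) g = 0" by blast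
  have fg: "cinner f g = 0" "cinner g f = 0" if "f \<in> F" "g \<in> G" for f g
  proof -
    show "cinner f g = 0"
    proof (rule cinner_cspan_eq_0)
      show "g \<in> cspan (insert u X)" using G(3) that by blast
      have "f \<noteq> u" using u(1) that(1) by blast
      then have "cinner f u = 0" using orthonormal_cinner[OF u(2), of f u] that(1) by simp
      moreover have "cinner f x = 0" if "x \<in> X" for x
        using X(3)[OF that, of f] \<open>f \<in> F\<close> cinner_eq_0_commute[of f x] by simp
      ultimately show "cinner f s = 0" if "s \<in> insert u X" for s using that by blast
    qed
    then show "cinner g f = 0" by (simp add: cinner_eq_0_commute[of g])
  qed
  have disj: "F \<inter> G = {}"
  proof (rule ccontr)
    assume "F \<inter> G \<noteq> {}"
    then obtain f where "f \<in> F" "f \<in> G" by blast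
    then show False using fg(1)[of f f] orthonormal_cinner[OF F(2), of f f] by simp
  qed
  have "cinner x y = (if x = y then 1 else 0)" if "x \<in> F \<union> G" "y \<in> F \<union> G" for x y
    using that fg[of x y] fg[of y x] disj orthonormal_cinner[OF F(2), of x y]
      orthonormal_cinner[OF G(2), of x y] by auto
  then have "orthonormal (F \<union> G)" unfolding orthonormal_def by blast
  moreover have "v \<in> cspan (F \<union> G)"
  proof -
    have "cspan G \<subseteq> cspan (F \<union> G)" by (intro complex_vector.span_mono) auto
    then have "insert u F \<subseteq> cspan (F \<union> G)"
      using G(4) complex_vector.span_superset[of "F \<union> G"] by auto
    then show ?thesis using u(3) cspan_subset by blast
  qed
  ultimately show ?thesis using F(1) G(1,5) by (intro exI[of _ "F \<union> G"]) auto
qed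

text \<open>E is the union of a chain of finite orthonormal sets whose spans swallow a dense
  sequence. F keeps its own diagonal: the empty F yields a zero diagonal, and an F of prescribed
  trace yields every value of the trace.\<close>

lemma zero_diagonal_extension:
  fixes D :: "'a::complex_hilbert \<Rightarrow> 'a"
  assumes sep: "separable_space (euclidean :: 'a topology)" and D: "is_idempotent D"
    and nHS: "\<not> hilbert_schmidt_on (corthogonal (ker D)) (nilpotent_part D)"
    and F: "finite F" "orthonormal F"
  obtains E where "orthonormal_basis UNIV E" "F \<subseteq> E" "\<And>e. e \<in> E - F \<Longrightarrow> cinner (D e) e = 0"
proof -
  obtain C :: "'a set" where C: "countable C" "closure C = UNIV"
    using sep by (auto simp: separable_space_def)
  have "C \<noteq> {}" using C(2) by auto
  then have v: "range (from_nat_into C) = C" using C(1) by (rule range_from_nat_into)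
  define Z where "Z G \<longleftrightarrow> finite G \<and> orthonormal G \<and> F \<subseteq> G \<and> (\<forall>g\<in>G - F. cinner (D g) g = 0)" for G
  have step: "\<exists>G'. Z G' \<and> G \<subseteq> G' \<and> from_nat_into C n \<in> cspan G'" if "Z G" for G n
  proof -
    have "finite G" "orthonormal G" using that by (auto simp: Z_def)
    from zero_diagonal_extension_step[OF D nHS this, of "from_nat_into C n"]
    obtain G' where "finite G'" "orthonormal G'" "G \<subseteq> G'" "from_nat_into C n \<in> cspan G'"
      "\<forall>f\<in>G' - G. cinner (D f) f = 0" by blast
    then show ?thesis using that by (intro exI[of _ G']) (auto simp: Z_def)
  qed
  have Z: "\<exists>G. Z G" using F by (intro exI[of _ F]) (simp add: Z_def)
  have "\<exists>H. \<forall>n. Z (H n) \<and> (H n \<subseteq> H (Suc n) \<and> from_nat_into C n \<in> cspan (H (Suc n)))"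
    by (rule dependent_nat_choice[of "\<lambda>_. Z", OF Z step])
  then obtain H where "\<forall>n. Z (H n) \<and> (H n \<subseteq> H (Suc n) \<and> from_nat_into C n \<in> cspan (H (Suc n)))"
    by (rule exE)
  then have H: "Z (H n)" "H n \<subseteq> H (Suc n)" "from_nat_into C n \<in> cspan (H (Suc n))" for n
    by simp_all
  have mono: "H m \<subseteq> H n" if "m \<le> n" for m n using H(2) that by (rule lift_Suc_mono_le)
  define E where "E = (\<Union>n. H n)"
  have "cinner x y = (if x = y then 1 else 0)" if xy: "x \<in> E" "y \<in> E" for x y
  proof -
    obtain m n where mn: "x \<in> H m" "y \<in> H n" using xy by (auto simp: E_def)
    have "x \<in> H (max m n)" "y \<in> H (max m n)"
      using mn mono[of m "max m n"] mono[of n "max m n"] by auto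
    moreover have "orthonormal (H (max m n))" using H(1) by (simp add: Z_def)
    ultimately show ?thesis using orthonormal_cinner by blast
  qed
  then have oE: "orthonormal E" unfolding orthonormal_def by blast
  have "C \<subseteq> cspan E"
  proof
    fix x assume "x \<in> C"
    then obtain n where "x = from_nat_into C n" using v by blast
    then have "x \<in> cspan (H (Suc n))" using H(3) by simp
    moreover have "cspan (H (Suc n)) \<subseteq> cspan E" by (intro complex_vector.span_mono) (auto simp: E_def)
    ultimately show "x \<in> cspan E" by blast
  qed
  then have "closure (cspan E) = UNIV" using closure_mono[of C "cspan E"] C(2) by auto
  with oE have "orthonormal_basis UNIV E" by (simp add: orthonormal_basis_iff)
  moreover have "F \<subseteq> E" using H(1)[of 0] by (auto simp: E_def Z_def)
  moreover have "cinner (D e) e = 0" if "e \<in> E - F" for e using that H(1) by (auto simp: E_def Z_def)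
  ultimately show thesis by (rule that)
qed

section \<open>The implications between the diagonal conditions\<close>

lemma absolutely_summable_diagonal_if_zero_diagonal:
  fixes D :: "'a::complex_inner \<Rightarrow> 'a"
  assumes "separable_space (euclidean :: 'a topology)" "infinite_cdim (UNIV :: 'a set)"
    and "zero_diagonal D"
  shows "absolutely_summable_diagonal D"
proof -
  obtain E where E: "orthonormal_basis UNIV E" "\<And>e. e \<in> E \<Longrightarrow> cinner (D e) e = 0"
    using assms(3) by (auto simp: zero_diagonal_def)
  obtain e where e: "orthonormal_basis_seq e" "range e = E"
    by (rule orthonormal_basis_enumerate[OF assms(1,2) E(1)])
  have "cinner (D (e j)) (e j) = 0" for j using E(2) e(2) by blast
  then have "summable (\<lambda>j. cmod (cinner (D (e j)) (e j)))" by simp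
  then show ?thesis using e(1) unfolding absolutely_summable_diagonal_def by blast
qed

lemma summable_diagonal_if_absolutely_summable_diagonal:
  assumes "absolutely_summable_diagonal D"
  shows "summable_diagonal D"
proof -
  obtain e where e: "orthonormal_basis_seq e" "summable (\<lambda>j. cmod (cinner (D (e j)) (e j)))"
    using assms by (auto simp: absolutely_summable_diagonal_def)
  have "(\<lambda>j. cinner (D (e j)) (e j)) sums (\<Sum>j. cinner (D (e j)) (e j))"
    by (rule summable_sums[OF summable_norm_cancel[OF e(2)]])
  with e(1) show ?thesis by (auto simp: summable_diagonal_def trace_set_def)
qed

text \<open>The value s is placed on finitely many basis vectors and all further entries vanish, so
  the series is a finite sum under any enumeration.\<close>

lemma trace_set_UNIV_if_not_nilpotent_part:
  fixes D :: "'a::complex_hilbert \<Rightarrow> 'a"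
  assumes sep: "separable_space (euclidean :: 'a topology)" and inf: "infinite_cdim (UNIV :: 'a set)"
    and D: "is_idempotent D"
    and nHS: "\<not> hilbert_schmidt_on (corthogonal (ker D)) (nilpotent_part D)"
  shows "trace_set D = UNIV"
proof -
  have "s \<in> trace_set D" for s
  proof -
    obtain F t where F: "finite F" "orthonormal F" and t: "(\<Sum>x\<in>F. t x) = (1::real)"
      "\<And>x. x \<in> F \<Longrightarrow> cinner (D x) x = of_real (t x) * s"
      by (rule prescribed_finite_trace[OF D nHS finite.emptyI]) blast
    obtain E where E: "orthonormal_basis UNIV E" "F \<subseteq> E" "\<And>e. e \<in> E - F \<Longrightarrow> cinner (D e) e = 0"
      by (rule zero_diagonal_extension[OF sep D nHS F]) blast
    obtain e where e: "orthonormal_basis_seq e" "range e = E"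
      by (rule orthonormal_basis_enumerate[OF sep inf E(1)])
    have inj: "inj e" using e(1) by (simp add: orthonormal_basis_seq_def)
    define J where "J = e -` F"
    have J: "finite J" "e ` J = F"
      using finite_vimageI[OF F(1) inj] E(2) e(2) by (auto simp: J_def)
    have "(\<lambda>j. cinner (D (e j)) (e j)) sums (\<Sum>j\<in>J. cinner (D (e j)) (e j))"
      using E(3) e(2) by (intro sums_finite J(1)) (auto simp: J_def)
    also have "(\<Sum>j\<in>J. cinner (D (e j)) (e j)) = (\<Sum>x\<in>F. cinner (D x) x)"
      unfolding J(2)[symmetric] using inj by (subst sum.reindex) (auto intro: inj_on_subset)
    also have "\<dots> = of_real (\<Sum>x\<in>F. t x) * s" using t(2) by (simp add: sum_distrib_right)
    finally show ?thesis using t(1) e(1) by (auto simp: trace_set_def)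
  qed
  then show ?thesis by blast
qed

theorem theorem2p5:
  fixes D :: "'a::complex_hilbert \<Rightarrow> 'a"
  assumes "separable_space (euclidean :: 'a topology)"
    and "infinite_cdim (UNIV :: 'a set)"
    and "is_idempotent D"
    and "infinite_cdim (range D)"
  shows "((\<not> (\<exists>P K. is_projection P \<and> hilbert_schmidt K \<and> D = (\<lambda>x. P x + K x)))
            \<longleftrightarrow> \<not> hilbert_schmidt_on (corthogonal (ker D)) (nilpotent_part D))
       \<and> ((\<not> hilbert_schmidt_on (corthogonal (ker D)) (nilpotent_part D))
            \<longleftrightarrow> trace_set D = UNIV)
       \<and> (trace_set D = UNIV \<longleftrightarrow> zero_diagonal D)
       \<and> (zero_diagonal D \<longleftrightarrow> absolutely_summable_diagonal D)
       \<and> (absolutely_summable_diagonal D \<longleftrightarrow> summable_diagonal D)"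
proof -
  let ?HS = "hilbert_schmidt_on (corthogonal (ker D)) (nilpotent_part D)"
  have "(\<exists>P K. is_projection P \<and> hilbert_schmidt K \<and> D = (\<lambda>x. P x + K x)) \<longleftrightarrow> ?HS"
    using hilbert_schmidt_perturbation_if_nilpotent_part[OF assms(3)]
      nilpotent_part_if_hilbert_schmidt_perturbation[OF assms(3)] by blast
  moreover have "\<not> ?HS \<Longrightarrow> trace_set D = UNIV"
    by (rule trace_set_UNIV_if_not_nilpotent_part[OF assms(1-3)])
  moreover have "zero_diagonal D" if nHS: "\<not> ?HS"
  proof -
    obtain E where "orthonormal_basis UNIV E" "\<And>e. e \<in> E - {} \<Longrightarrow> cinner (D e) e = 0"
      by (rule zero_diagonal_extension[OF assms(1,3) nHS finite.emptyI orthonormal_empty]) blast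
    then show ?thesis by (auto simp: zero_diagonal_def)
  qed
  moreover have "zero_diagonal D \<Longrightarrow> absolutely_summable_diagonal D"
    by (rule absolutely_summable_diagonal_if_zero_diagonal[OF assms(1,2)])
  moreover have "absolutely_summable_diagonal D \<Longrightarrow> summable_diagonal D"
    by (rule summable_diagonal_if_absolutely_summable_diagonal)
  moreover have "trace_set D = UNIV \<Longrightarrow> summable_diagonal D"
    by (simp add: summable_diagonal_def)
  \<comment> \<open>This closes the cycle: the weakest diagonal condition already excludes a
    Hilbert-Schmidt nilpotent part.\<close>
  moreover have "?HS \<Longrightarrow> \<not> summable_diagonal D"
    by (rule not_summable_diagonal_if_nilpotent_part[OF assms(3,4)])
  ultimately show ?thesis by blast
qed

end
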